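(* Let a discrete group $\Gamma$ act properly and cocompactly on a locally compact second-countable Hausdorff space $X$, and let $\mu$ be a $\Gamma$-invariant non-zero regular measure on $X$. Then $\Gamma$ is non-amenable if and only if the coarse space $(X,\mathcal{E}^X_\Gamma)$ has a $\mu$-PS.
   Context: Actions are continuous actions (by homeomorphisms). For $S\subset X$ put $\Gamma_S=\{g\in\Gamma:gS\cap S\ne\emptyset\}$. The action is proper if $\Gamma_S$ is compact (i.e. finite, as $\Gamma$ is discrete) for every compact $S\subset X$, and cocompact if there is a compact $S_0\subset X$ with $X=\Gamma S_0$. For $E\subset X\times X$, $E_x=\{y\in X:(x,y)\in E\}$. The coarse structure $\mathcal{E}^X_\Gamma$ is the collection of all $E\subset X\times X$ such that $E\subset E_{\Gamma,C}:=\bigcup_{g\in\Gamma}gC\times gC$ for some compact $C\subset X$; its elements are called controlled sets. $X$ carries its Borel $\sigma$-algebra $\mathcal{B}=\mathcal{B}(X)$, and $\mathcal{B}\times\mathcal{B}$ is the product $\sigma$-algebra. A regular measure is a Borel measure that is finite on compact sets, outer regular on Borel sets and inner regular on open sets. (Under the hypotheses, every controlled set is contained in a controlled set belonging to $\mathcal{B}\times\mathcal{B}$, $\mu$ is $\sigma$-finite, and $\sup_{x}\mu(E_x)<\infty$ for each $E\in\mathcal{E}^X_\Gamma\cap(\mathcal{B}\times\mathcal{B})$, so that the following notions are well defined.) A $\mu$-0 chain is an element $f\in L^\infty(X,\mu)$ (real-valued). It is effective if $f\ge0$ $\mu$-a.e. and there is $E\in\mathcal{E}^X_\Gamma\cap(\mathcal{B}\times\mathcal{B})$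 with $\int_{E_{x_0}}f\,d\mu\ge1$ for all $x_0\in X$. A $\mu$-1 chain is a function $c:X\times X\to\mathbb{R}$ that is essentially bounded with respect to $\mu\otimes\mu$ and for which there is $E_c\in\mathcal{E}^X_\Gamma\cap(\mathcal{B}\times\mathcal{B})$ with $\int_{X\times X\setminus E_c}|c|\,d\mu\otimes\mu=0$. Its boundary is the $\mu$-0 chain $\partial c(x)=\int_Xc(y,x)\,d\mu(y)-\int_Xc(x,y)\,d\mu(y)$. A $\mu$-PS is a $\mu$-1 chain $c$ whose boundary $\partial c$ is effective. A discrete group $\Gamma$ is amenable if there is a linear functional $m$ on $\ell^\infty(\Gamma)$ with $m(f)\ge0$ for all $f\ge0$, $m(1)=1$, and $m(g\cdot f)=m(f)$ for all $g\in\Gamma$, $f\in\ell^\infty(\Gamma)$, where $g\cdot f$ is the left translate of $f$ by $g$. *)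

theory Defs
  imports "HOL-Analysis.Analysis" "HOL-Algebra.Group_Action"
begin

section \<open>Amenability\<close>

text \<open>
  Bounded real functions on the carrier are represented by functions that are extensional on
  it, so that every element of $\ell^\infty(\Gamma)$ has exactly one representative.
\<close>

definition ell_inf :: "('g, 'b) monoid_scheme \<Rightarrow> ('g \<Rightarrow> real) set" where
  "ell_inf G = {f \<in> extensional (carrier G). bounded (f ` carrier G)}"

definition left_translate ::
    "('g, 'b) monoid_scheme \<Rightarrow> 'g \<Rightarrow> ('g \<Rightarrow> real) \<Rightarrow> 'g \<Rightarrow> real" where
  "left_translate G g f = (\<lambda>x\<in>carrier G. f (inv\<^bsub>G\<^esub> g \<otimes>\<^bsub>G\<^esub> x))"

definition invariant_mean ::
    "('g, 'b) monoid_scheme \<Rightarrow> (('g \<Rightarrow> real) \<Rightarrow> real) \<Rightarrow> bool" where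
  "invariant_mean G m \<longleftrightarrow>
     (\<forall>f\<in>ell_inf G. \<forall>h\<in>ell_inf G. m (\<lambda>x\<in>carrier G. f x + h x) = m f + m h) \<and>
     (\<forall>a. \<forall>f\<in>ell_inf G. m (\<lambda>x\<in>carrier G. a * f x) = a * m f) \<and>
     (\<forall>f\<in>ell_inf G. (\<forall>x\<in>carrier G. f x \<ge> 0) \<longrightarrow> m f \<ge> 0) \<and>
     m (\<lambda>x\<in>carrier G. 1) = 1 \<and>
     (\<forall>g\<in>carrier G. \<forall>f\<in>ell_inf G. m (left_translate G g f) = m f)"

definition amenable :: "('g, 'b) monoid_scheme \<Rightarrow> bool" where
  "amenable G \<longleftrightarrow> (\<exists>m. invariant_mean G m)"


section \<open>Group actions on topological spaces\<close>

text \<open>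
  The group is discrete, so continuity of the action is continuity of each single map; these
  maps are then homeomorphisms because the inverse of \<open>\<phi> g\<close> is \<open>\<phi>\<close> of the inverse of \<open>g\<close>.
\<close>

definition continuous_action ::
    "('g, 'b) monoid_scheme \<Rightarrow> ('g \<Rightarrow> 'x::topological_space \<Rightarrow> 'x) \<Rightarrow> bool" where
  "continuous_action G \<phi> \<longleftrightarrow>
     group_action G UNIV \<phi> \<and> (\<forall>g\<in>carrier G. continuous_on UNIV (\<phi> g))"

definition meeting_set ::
    "('g, 'b) monoid_scheme \<Rightarrow> ('g \<Rightarrow> 'x \<Rightarrow> 'x) \<Rightarrow> 'x set \<Rightarrow> 'g set" where
  "meeting_set G \<phi> S = {g \<in> carrier G. \<phi> g ` S \<inter> S \<noteq> {}}"

definition proper_action ::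
    "('g, 'b) monoid_scheme \<Rightarrow> ('g \<Rightarrow> 'x::topological_space \<Rightarrow> 'x) \<Rightarrow> bool" where
  "proper_action G \<phi> \<longleftrightarrow> (\<forall>S. compact S \<longrightarrow> finite (meeting_set G \<phi> S))"

definition cocompact_action ::
    "('g, 'b) monoid_scheme \<Rightarrow> ('g \<Rightarrow> 'x::topological_space \<Rightarrow> 'x) \<Rightarrow> bool" where
  "cocompact_action G \<phi> \<longleftrightarrow> (\<exists>S. compact S \<and> (\<Union>g\<in>carrier G. \<phi> g ` S) = UNIV)"

definition controlled_sets ::
    "('g, 'b) monoid_scheme \<Rightarrow> ('g \<Rightarrow> 'x::topological_space \<Rightarrow> 'x) \<Rightarrow> ('x \<times> 'x) set set" where
  "controlled_sets G \<phi> =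
     {E. \<exists>C. compact C \<and> E \<subseteq> (\<Union>g\<in>carrier G. (\<phi> g ` C) \<times> (\<phi> g ` C))}"


section \<open>Measures\<close>

definition regular_measure :: "'x::topological_space measure \<Rightarrow> bool" where
  "regular_measure \<mu> \<longleftrightarrow>
     sets \<mu> = sets borel \<and>
     (\<forall>K. compact K \<longrightarrow> emeasure \<mu> K < \<infinity>) \<and>
     (\<forall>A\<in>sets borel. emeasure \<mu> A = (INF U\<in>{U. open U \<and> A \<subseteq> U}. emeasure \<mu> U)) \<and>
     (\<forall>U. open U \<longrightarrow> emeasure \<mu> U = (SUP K\<in>{K. compact K \<and> K \<subseteq> U}. emeasure \<mu> K))"

definition invariant_measure ::
    "('g, 'b) monoid_scheme \<Rightarrow> ('g \<Rightarrow> 'x \<Rightarrow> 'x) \<Rightarrow> 'x measure \<Rightarrow> bool" where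
  "invariant_measure G \<phi> \<mu> \<longleftrightarrow>
     (\<forall>g\<in>carrier G. \<forall>A\<in>sets \<mu>. emeasure \<mu> (\<phi> g ` A) = emeasure \<mu> A)"

text \<open>Functions representing an element of $L^\infty$.\<close>

definition ess_bounded :: "'a measure \<Rightarrow> ('a \<Rightarrow> real) \<Rightarrow> bool" where
  "ess_bounded M f \<longleftrightarrow> f \<in> borel_measurable M \<and> (\<exists>B. AE x in M. \<bar>f x\<bar> \<le> B)"


section \<open>Chains and Ponzi schemes\<close>

text \<open>
  Chains are represented by functions rather than by almost-everywhere classes; none of the
  notions below depends on the representative.  In what follows \<open>\<E>\<close> is a coarse structure,
  and \<open>E `` {x}\<close> is the section $E_x = \{y \mid (x,y) \in E\}$.
\<close>

definition zero_chain :: "'x measure \<Rightarrow> ('x \<Rightarrow> real) \<Rightarrow> bool" where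
  "zero_chain \<mu> f \<longleftrightarrow> ess_bounded \<mu> f"

definition effective_chain ::
    "('x \<times> 'x) set set \<Rightarrow> 'x measure \<Rightarrow> ('x \<Rightarrow> real) \<Rightarrow> bool" where
  "effective_chain \<E> \<mu> f \<longleftrightarrow>
     zero_chain \<mu> f \<and> (AE x in \<mu>. f x \<ge> 0) \<and>
     (\<exists>E \<in> \<E> \<inter> sets (\<mu> \<Otimes>\<^sub>M \<mu>). \<forall>x. (LINT y:(E `` {x})|\<mu>. f y) \<ge> 1)"

text \<open>
  The vanishing condition uses the integral of nonnegative extended-real functions, because
  the Bochner integral would also be 0 for a non-integrable \<open>c\<close>.
\<close>

definition one_chain ::
    "('x \<times> 'x) set set \<Rightarrow> 'x measure \<Rightarrow> ('x \<times> 'x \<Rightarrow> real) \<Rightarrow> bool" where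
  "one_chain \<E> \<mu> c \<longleftrightarrow>
     ess_bounded (\<mu> \<Otimes>\<^sub>M \<mu>) c \<and>
     (\<exists>E \<in> \<E> \<inter> sets (\<mu> \<Otimes>\<^sub>M \<mu>). (\<integral>\<^sup>+p\<in>- E. ennreal \<bar>c p\<bar> \<partial>(\<mu> \<Otimes>\<^sub>M \<mu>)) = 0)"

definition boundary :: "'x measure \<Rightarrow> ('x \<times> 'x \<Rightarrow> real) \<Rightarrow> 'x \<Rightarrow> real" where
  "boundary \<mu> c x = (LINT y|\<mu>. c (y, x)) - (LINT y|\<mu>. c (x, y))"

definition ponzi_scheme ::
    "('x \<times> 'x) set set \<Rightarrow> 'x measure \<Rightarrow> ('x \<times> 'x \<Rightarrow> real) \<Rightarrow> bool" where
  "ponzi_scheme \<E> \<mu> c \<longleftrightarrow> one_chain \<E> \<mu> c \<and> effective_chain \<E> \<mu> (boundary \<mu> c)"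

end

theory Submission
  imports Defs
begin

text \<open>
  The theorem is proved by passing through a statement about the group alone.  Call a finite sum
  of functions \<open>x \<mapsto> b x - b (g\<inverse> x)\<close> with \<open>b\<close> bounded a translation defect.  A discrete group is
  non-amenable if and only if some translation defect is bounded below by 1.  An invariant mean
  annihilates every defect and therefore excludes such a bound.  Conversely, if no defect is
  bounded below by 1, then the infimum, over all defects \<open>v\<close>, of the least upper bound of \<open>f + v\<close>
  is a finite sublinear functional of \<open>f\<close>.  A linear functional dominated by it
  (\<open>linear_functional_below_sublinear\<close>) is an invariant mean.

  To move between \<open>\<Gamma>\<close> and \<open>X\<close>, fix a compact set \<open>S\<close> whose translates, the tiles, cover \<open>X\<close>.  By
  properness each point lies in at most a fixed finite number of tiles, \<open>\<Gamma>\<close> is countable, and all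
  tiles have the same finite positive measure.

  A defect \<open>b x - b (h\<inverse> x)\<close> is realised on \<open>X\<close> by the chain that carries the amount
  \<open>b (g\<inverse>)\<close> from the tile of \<open>g h\<inverse>\<close> to the tile of \<open>g\<close>, for every \<open>g\<close>.  Up to the factor \<open>\<mu> S\<close>, its
  boundary at a point is the sum of the values of the defect at \<open>g\<inverse>\<close> over the tiles \<open>g S\<close> through
  that point (\<open>defect_is_boundary\<close>), so that a defect bounded below by a positive constant gives an
  effective boundary.

  Conversely, cut \<open>X\<close> into disjoint Borel pieces \<open>A g\<close>, one inside each tile, and let \<open>T g h\<close> be the
  integral of a given 1-chain over \<open>A g \<times> A h\<close>.  Since the chain is controlled, \<open>T g h\<close> vanishes
  unless \<open>g\<inverse> h\<close> lies in a fixed finite symmetric set, so the integral \<open>F g\<close> of the boundary over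
  \<open>A g\<close> is a finite sum of differences of values of \<open>T\<close> (\<open>flux_through_pieces\<close>), and \<open>F\<close> composed with
  inversion is a defect.  If the boundary is effective, then a sum of finitely many translates of
  this defect is at least 1 everywhere (\<open>effective_chain_mass\<close>).

  The inversion appears in both directions because in an action on the left the neighbours of \<open>g\<close>
  are its right translates \<open>g p\<close>, while the mean is invariant under left translations.
\<close>


section \<open>Dominated extension on spaces of real functions\<close>

text \<open>
  Linear subspaces are described by closure conditions, with the operations spelled out pointwise:
  in this form the results apply to the functions that are bounded on the carrier of a group.
\<close>

definition function_space :: "('a \<Rightarrow> real) set \<Rightarrow> bool" where
  "function_space V \<longleftrightarrow> (\<lambda>x. 0) \<in> V \<and> (\<forall>f\<in>V. \<forall>h\<in>V. (\<lambda>x. f x + h x) \<in> V) \<and>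
     (\<forall>a. \<forall>f\<in>V. (\<lambda>x. a * f x) \<in> V)"

definition sublinear_on :: "('a \<Rightarrow> real) set \<Rightarrow> (('a \<Rightarrow> real) \<Rightarrow> real) \<Rightarrow> bool" where
  "sublinear_on V q \<longleftrightarrow> (\<forall>f\<in>V. \<forall>h\<in>V. q (\<lambda>x. f x + h x) \<le> q f + q h) \<and>
     (\<forall>a>0. \<forall>f\<in>V. q (\<lambda>x. a * f x) \<le> a * q f)"

lemma function_spaceD:
  assumes "function_space V"
  shows "(\<lambda>x. 0) \<in> V" "f \<in> V \<Longrightarrow> h \<in> V \<Longrightarrow> (\<lambda>x. f x + h x) \<in> V"
    "f \<in> V \<Longrightarrow> (\<lambda>x. a * f x) \<in> V"
  using assms by (auto simp: function_space_def)

lemma sublinear_onD: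
  assumes "sublinear_on V q"
  shows "f \<in> V \<Longrightarrow> h \<in> V \<Longrightarrow> q (\<lambda>x. f x + h x) \<le> q f + q h"
    "a > 0 \<Longrightarrow> f \<in> V \<Longrightarrow> q (\<lambda>x. a * f x) \<le> a * q f"
  using assms by (auto simp: sublinear_on_def)

lemma sublinear_on_zero:
  assumes "function_space V" "sublinear_on V q"
  shows "q (\<lambda>x. 0) = 0"
  using sublinear_onD(2)[OF assms(2), of 2 "\<lambda>x. 0"] sublinear_onD(2)[OF assms(2), of "1/2" "\<lambda>x. 0"]
    function_spaceD(1)[OF assms(1)] by simp

lemma sublinear_on_lower_bound:
  assumes V: "function_space V" and q: "sublinear_on V q" and f: "f \<in> V"
  shows "- q (\<lambda>x. - f x) \<le> q f"
proof -
  have "(\<lambda>x. - f x) \<in> V" using function_spaceD(3)[OF V f, of "-1"] by simp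
  then have "q (\<lambda>x. f x + - f x) \<le> q f + q (\<lambda>x. - f x)"
    using sublinear_onD(1)[OF q f] by blast
  then show ?thesis using sublinear_on_zero[OF V q] by simp
qed

text \<open>
  The functional \<open>r u = inf (q (u + t h) - t q h)\<close>, over \<open>t \<ge> 0\<close>, is again sublinear and at most \<open>q\<close>
  (take \<open>t = 0\<close>).  Minimality forces \<open>r = q\<close>, and \<open>t = 1\<close> then gives the inequality.
\<close>

lemma minimal_sublinear_superadditive:
  assumes V: "function_space V" and q: "sublinear_on V q"
    and minimal: "\<And>r. sublinear_on V r \<Longrightarrow> (\<forall>f\<in>V. r f \<le> q f) \<Longrightarrow> (\<forall>f\<in>V. r f = q f)"
    and f: "f \<in> V" and h: "h \<in> V"
  shows "q f + q h \<le> q (\<lambda>x. f x + h x)"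
proof -
  define \<Phi> where "\<Phi> t u = q (\<lambda>x. u x + t * h x) - t * q h" for t u
  define r where "r u = (INF t\<in>{0..}. \<Phi> t u)" for u
  note Vs = function_spaceD[OF V]
  have below: "- q (\<lambda>x. - u x) \<le> \<Phi> t u" if u: "u \<in> V" and t: "t \<ge> 0" for u t
  proof -
    have mu: "(\<lambda>x. - u x) \<in> V" using Vs(3)[OF u, of "-1"] by simp
    have "t * q h \<le> q (\<lambda>x. t * h x)"
    proof (cases "t = 0")
      case True then show ?thesis using sublinear_on_zero[OF V q] by simp
    next
      case False
      then have "q (\<lambda>x. (1/t) * (t * h x)) \<le> (1/t) * q (\<lambda>x. t * h x)"
        using t sublinear_onD(2)[OF q _ Vs(3)[OF h, of t], of "1/t"] by simp
      then show ?thesis using False t by (simp add: field_simps)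
    qed
    also have "q (\<lambda>x. t * h x) = q (\<lambda>x. (u x + t * h x) + - u x)" by simp
    also have "\<dots> \<le> q (\<lambda>x. u x + t * h x) + q (\<lambda>x. - u x)"
      by (rule sublinear_onD(1)[OF q Vs(2)[OF u Vs(3)[OF h]] mu])
    finally show ?thesis by (simp add: \<Phi>_def)
  qed
  have bdd: "bdd_below ((\<lambda>t. \<Phi> t u) ` {0..})" if "u \<in> V" for u
    using below[OF that] by (intro bdd_belowI[where m="- q (\<lambda>x. - u x)"]) auto
  have r_le: "r u \<le> \<Phi> t u" if "u \<in> V" "t \<ge> 0" for u t
    unfolding r_def using that by (intro cINF_lower bdd) auto
  have r_ge: "y \<le> r u" if "\<And>t. t \<ge> 0 \<Longrightarrow> y \<le> \<Phi> t u" for u y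
    unfolding r_def using that by (intro cINF_greatest) auto
  have "sublinear_on V r"
    unfolding sublinear_on_def
  proof (intro conjI ballI allI impI)
    fix u w assume u: "u \<in> V" and w: "w \<in> V"
    have "r (\<lambda>x. u x + w x) \<le> \<Phi> s u + \<Phi> t w" if s: "s \<ge> 0" and t: "t \<ge> 0" for s t
    proof -
      have "r (\<lambda>x. u x + w x) \<le> \<Phi> (s + t) (\<lambda>x. u x + w x)"
        using s t by (intro r_le Vs u w) auto
      also have "q (\<lambda>x. u x + w x + (s + t) * h x)
          = q (\<lambda>x. (u x + s * h x) + (w x + t * h x))" by (simp add: algebra_simps)
      then have "\<Phi> (s + t) (\<lambda>x. u x + w x) \<le> \<Phi> s u + \<Phi> t w"
        using sublinear_onD(1)[OF q Vs(2)[OF u Vs(3)[OF h, of s]] Vs(2)[OF w Vs(3)[OF h, of t]]]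
        by (simp add: \<Phi>_def algebra_simps)
      finally show ?thesis .
    qed
    then have "r (\<lambda>x. u x + w x) - \<Phi> s u \<le> r w" if "s \<ge> 0" for s
      using that by (intro r_ge) (metis add.commute diff_le_eq)
    then have "r (\<lambda>x. u x + w x) - r w \<le> r u"
      by (intro r_ge) (metis add.commute diff_le_eq)
    then show "r (\<lambda>x. u x + w x) \<le> r u + r w" by simp
  next
    fix a :: real and u assume a: "a > 0" and u: "u \<in> V"
    have "r (\<lambda>x. a * u x) / a \<le> \<Phi> t u" if t: "t \<ge> 0" for t
    proof -
      have "r (\<lambda>x. a * u x) \<le> \<Phi> (a * t) (\<lambda>x. a * u x)"
        using a t by (intro r_le Vs u) auto
      also have "q (\<lambda>x. a * u x + a * t * h x) = q (\<lambda>x. a * (u x + t * h x))"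
        by (simp add: algebra_simps)
      then have "\<Phi> (a * t) (\<lambda>x. a * u x) \<le> a * \<Phi> t u"
        using sublinear_onD(2)[OF q a Vs(2)[OF u Vs(3)[OF h, of t]]]
        by (simp add: \<Phi>_def algebra_simps)
      finally show ?thesis using a by (simp add: field_simps)
    qed
    then have "r (\<lambda>x. a * u x) / a \<le> r u" by (rule r_ge)
    then show "r (\<lambda>x. a * u x) \<le> a * r u" using a by (simp add: field_simps)
  qed
  moreover have "\<forall>u\<in>V. r u \<le> q u"
    using r_le[of _ 0] by (simp add: \<Phi>_def)
  ultimately have "q f = r f" using minimal f by metis
  also have "\<dots> \<le> \<Phi> 1 f" using f by (rule r_le) simp
  finally show ?thesis by (simp add: \<Phi>_def)
qed

text \<open>
  Zorn's lemma applies because the pointwise infimum of a chain of sublinear functionals is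
  sublinear; it is finite because \<open>q f \<ge> - p (- f)\<close> for every sublinear \<open>q \<le> p\<close>.
\<close>

lemma exists_minimal_sublinear:
  assumes V: "function_space V" and p: "sublinear_on V p"
  obtains q where "sublinear_on V q" "\<forall>f\<in>V. q f \<le> p f"
    "\<And>r. sublinear_on V r \<Longrightarrow> (\<forall>f\<in>V. r f \<le> q f) \<Longrightarrow> (\<forall>f\<in>V. r f = q f)"
proof -
  note Vs = function_spaceD[OF V]
  \<comment> \<open>extensionality makes the comparison on \<open>V\<close> antisymmetric\<close>
  define Q where "Q = {q \<in> extensional V. sublinear_on V q \<and> (\<forall>f\<in>V. q f \<le> p f)}"
  define P where "P q r \<longleftrightarrow> (\<forall>f\<in>V. r f \<le> q f)" for q r :: "('a \<Rightarrow> real) \<Rightarrow> real"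
  have restrict: "sublinear_on V (restrict r V)" if "sublinear_on V r" for r
    using that Vs by (simp add: sublinear_on_def)
  have po: "partial_order_on Q (relation_of P Q)"
    by (rule partial_order_on_relation_ofI)
       (auto simp: P_def Q_def intro: order.trans, meson extensionalityI order.antisym)
  have "\<exists>u\<in>Q. \<forall>a\<in>C. P a u" if C: "C \<in> Chains (relation_of P Q)" for C
  proof (cases "C = {}")
    case True
    have "restrict p V \<in> Q" using restrict[OF p] by (simp add: Q_def)
    then show ?thesis using True by blast
  next
    case False
    have CQ: "C \<subseteq> Q" and lin: "\<And>a b. a \<in> C \<Longrightarrow> b \<in> C \<Longrightarrow> P a b \<or> P b a"
      using C by (auto simp: Chains_def relation_of_def)
    have sub: "sublinear_on V a" and le_p: "\<And>f. f \<in> V \<Longrightarrow> a f \<le> p f" if "a \<in> C" for a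
      using that CQ by (auto simp: Q_def)
    define u where "u f = (INF a\<in>C. a f)" for f
    have bdd: "bdd_below ((\<lambda>a. a f) ` C)" if f: "f \<in> V" for f
    proof (rule bdd_belowI2)
      fix a assume a: "a \<in> C"
      have "(\<lambda>x. - f x) \<in> V" using Vs(3)[OF f, of "-1"] by simp
      then show "- p (\<lambda>x. - f x) \<le> a f"
        using sublinear_on_lower_bound[OF V sub[OF a] f] le_p[OF a] by fastforce
    qed
    have u_le: "u f \<le> a f" if "f \<in> V" "a \<in> C" for f a
      unfolding u_def using that by (intro cINF_lower bdd)
    have u_ge: "y \<le> u f" if "\<And>a. a \<in> C \<Longrightarrow> y \<le> a f" for y f
      unfolding u_def using that False by (intro cINF_greatest) auto
    have "sublinear_on V u"
      unfolding sublinear_on_def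
    proof (intro conjI ballI allI impI)
      fix f h assume f: "f \<in> V" and h: "h \<in> V"
      have "u (\<lambda>x. f x + h x) \<le> a f + b h" if a: "a \<in> C" and b: "b \<in> C" for a b
      proof -
        obtain c where c: "c \<in> C" "c f \<le> a f" "c h \<le> b h"
          using lin[OF a b] a b f h by (auto simp: P_def)
        have "u (\<lambda>x. f x + h x) \<le> c (\<lambda>x. f x + h x)" by (rule u_le[OF Vs(2)[OF f h] c(1)])
        also have "\<dots> \<le> c f + c h" by (rule sublinear_onD(1)[OF sub[OF c(1)] f h])
        finally show ?thesis using c by simp
      qed
      then have "u (\<lambda>x. f x + h x) - a f \<le> u h" if "a \<in> C" for a
        using that by (intro u_ge) (metis add.commute diff_le_eq)
      then have "u (\<lambda>x. f x + h x) - u h \<le> u f"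
        by (intro u_ge) (metis add.commute diff_le_eq)
      then show "u (\<lambda>x. f x + h x) \<le> u f + u h" by simp
    next
      fix a :: real and f assume a: "a > 0" and f: "f \<in> V"
      have "u (\<lambda>x. a * f x) / a \<le> b f" if b: "b \<in> C" for b
        using u_le[OF Vs(3)[OF f, of a] b] sublinear_onD(2)[OF sub[OF b] a f] a
        by (simp add: field_simps)
      then have "u (\<lambda>x. a * f x) / a \<le> u f" by (rule u_ge)
      then show "u (\<lambda>x. a * f x) \<le> a * u f" using a by (simp add: field_simps)
    qed
    moreover have "u f \<le> p f" if "f \<in> V" for f
      using False u_le[OF that] le_p that by (meson all_not_in_conv order.trans)
    ultimately have "restrict u V \<in> Q" using restrict by (auto simp: Q_def)
    moreover have "P a (restrict u V)" if "a \<in> C" for a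
      using u_le that by (simp add: P_def)
    ultimately show ?thesis by blast
  qed
  from predicate_Zorn[OF po this] obtain q
    where q: "q \<in> Q" and max: "\<And>a. a \<in> Q \<Longrightarrow> P q a \<Longrightarrow> a = q" by blast
  show thesis
  proof (rule that[of q])
    show "sublinear_on V q" "\<forall>f\<in>V. q f \<le> p f" using q by (auto simp: Q_def)
    fix r assume r: "sublinear_on V r" "\<forall>f\<in>V. r f \<le> q f"
    have "restrict r V \<in> Q" using q r restrict[OF r(1)] by (fastforce simp: Q_def)
    moreover have "P q (restrict r V)" using r by (simp add: P_def)
    ultimately have "restrict r V = q" by (rule max)
    then show "\<forall>f\<in>V. r f = q f" by force
  qed
qed

text \<open>
  This is the Hahn-Banach theorem for extension from the zero subspace.  A minimal sublinear
  functional is additive, hence linear.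
\<close>

theorem linear_functional_below_sublinear:
  assumes V: "function_space V" and p: "sublinear_on V p"
  obtains m where "\<And>f h. f \<in> V \<Longrightarrow> h \<in> V \<Longrightarrow> m (\<lambda>x. f x + h x) = m f + m h"
    "\<And>a f. f \<in> V \<Longrightarrow> m (\<lambda>x. a * f x) = a * m f" "\<And>f. f \<in> V \<Longrightarrow> m f \<le> p f"
proof -
  note Vs = function_spaceD[OF V]
  obtain q where q: "sublinear_on V q" "\<forall>f\<in>V. q f \<le> p f"
    and minimal: "\<And>r. sublinear_on V r \<Longrightarrow> (\<forall>f\<in>V. r f \<le> q f) \<Longrightarrow> (\<forall>f\<in>V. r f = q f)"
    using exists_minimal_sublinear[OF V p] by blast
  have add: "q (\<lambda>x. f x + h x) = q f + q h" if "f \<in> V" "h \<in> V" for f h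
    using minimal_sublinear_superadditive[OF V q(1) minimal that] sublinear_onD(1)[OF q(1) that]
    by fastforce
  have pos: "q (\<lambda>x. a * f x) = a * q f" if a: "a > 0" and f: "f \<in> V" for a f
  proof (rule order.antisym)
    show "q (\<lambda>x. a * f x) \<le> a * q f" by (rule sublinear_onD(2)[OF q(1) a f])
    have "q (\<lambda>x. (1/a) * (a * f x)) \<le> (1/a) * q (\<lambda>x. a * f x)"
      using a by (intro sublinear_onD(2)[OF q(1)] Vs f) simp
    then show "a * q f \<le> q (\<lambda>x. a * f x)" using a by (simp add: field_simps)
  qed
  have zero: "q (\<lambda>x. 0) = 0" by (rule sublinear_on_zero[OF V q(1)])
  have "q (\<lambda>x. a * f x) = a * q f" if f: "f \<in> V" for a f
  proof -
    consider "a > 0" | "a = 0" | "a < 0" by linarith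
    then show ?thesis
    proof cases
      case 3
      have "q (\<lambda>x. a * f x + (- a) * f x) = q (\<lambda>x. a * f x) + q (\<lambda>x. (- a) * f x)"
        by (intro add Vs f)
      then show ?thesis using pos[of "-a" f] f 3 zero by simp
    qed (use pos f zero in auto)
  qed
  then show thesis using that add q(2) by blast
qed


section \<open>Amenability and translation defects\<close>

text \<open>
  The closure rule \<open>cong\<close> identifies functions that agree on the carrier.  The set is then a linear
  space, namely the span of all differences between a bounded function and its left translate.
\<close>

inductive_set translation_defects :: "('g, 'b) monoid_scheme \<Rightarrow> ('g \<Rightarrow> real) set"
  for G (structure) where
  defect: "g \<in> carrier G \<Longrightarrow> bounded (b ` carrier G) \<Longrightarrow>
      (\<lambda>x. b x - b (inv g \<otimes> x)) \<in> translation_defects G"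
| add: "v \<in> translation_defects G \<Longrightarrow> w \<in> translation_defects G \<Longrightarrow>
      (\<lambda>x. v x + w x) \<in> translation_defects G"
| cong: "v \<in> translation_defects G \<Longrightarrow> (\<And>x. x \<in> carrier G \<Longrightarrow> v x = w x) \<Longrightarrow>
      w \<in> translation_defects G"

definition bounded_functions :: "('g, 'b) monoid_scheme \<Rightarrow> ('g \<Rightarrow> real) set" where
  "bounded_functions G = {f. bounded (f ` carrier G)}"

lemma bounded_functionsI:
  "(\<And>x. x \<in> carrier G \<Longrightarrow> \<bar>f x\<bar> \<le> B) \<Longrightarrow> f \<in> bounded_functions G"
  by (auto simp: bounded_functions_def bounded_iff)

lemma bounded_functionsE:
  assumes "f \<in> bounded_functions G"
  obtains B where "B \<ge> 0" "\<And>x. x \<in> carrier G \<Longrightarrow> \<bar>f x\<bar> \<le> B"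
  using assms by (auto simp: bounded_functions_def bounded_pos intro: less_imp_le)

lemma function_space_bounded_functions: "function_space (bounded_functions G)"
  unfolding function_space_def
proof (intro conjI ballI allI)
  show "(\<lambda>x. 0) \<in> bounded_functions G" by (rule bounded_functionsI[of _ _ 0]) simp
next
  fix f h assume "f \<in> bounded_functions G" "h \<in> bounded_functions G"
  then obtain A B where "\<And>x. x \<in> carrier G \<Longrightarrow> \<bar>f x\<bar> \<le> A" "\<And>x. x \<in> carrier G \<Longrightarrow> \<bar>h x\<bar> \<le> B"
    by (metis bounded_functionsE)
  then show "(\<lambda>x. f x + h x) \<in> bounded_functions G"
    by (intro bounded_functionsI[of _ _ "A + B"]) (smt (verit))
next
  fix a and f assume "f \<in> bounded_functions G"
  then obtain A where "\<And>x. x \<in> carrier G \<Longrightarrow> \<bar>f x\<bar> \<le> A" by (metis bounded_functionsE)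
  then show "(\<lambda>x. a * f x) \<in> bounded_functions G"
    by (intro bounded_functionsI[of _ _ "\<bar>a\<bar> * A"]) (simp add: abs_mult mult_left_mono)
qed

lemmas bounded_functions_closed = function_spaceD[OF function_space_bounded_functions]

lemma (in group) bounded_functions_translate:
  assumes "f \<in> bounded_functions G" "g \<in> carrier G"
  shows "(\<lambda>x. f (g \<otimes> x)) \<in> bounded_functions G"
proof -
  obtain B where "\<And>x. x \<in> carrier G \<Longrightarrow> \<bar>f x\<bar> \<le> B" using assms by (metis bounded_functionsE)
  then show ?thesis using assms by (intro bounded_functionsI[of _ _ B]) auto
qed

lemma (in group) defectI:
  "g \<in> carrier G \<Longrightarrow> b \<in> bounded_functions G \<Longrightarrow>
    (\<lambda>x. b x - b (inv g \<otimes> x)) \<in> translation_defects G"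
  by (auto simp: bounded_functions_def intro: translation_defects.defect)

lemma (in group) translation_defects_bounded:
  "v \<in> translation_defects G \<Longrightarrow> v \<in> bounded_functions G"
proof (induction rule: translation_defects.induct)
  case (defect g b)
  then have b: "b \<in> bounded_functions G" by (simp add: bounded_functions_def)
  have "(\<lambda>x. b x + (-1) * b (inv g \<otimes> x)) \<in> bounded_functions G"
    using defect by (intro bounded_functions_closed b bounded_functions_translate) auto
  then show ?case by simp
next
  case (cong v w)
  then show ?case by (simp add: bounded_functions_def cong: image_cong)
qed (auto intro: bounded_functions_closed)

lemma (in group) translation_defects_scale:
  "v \<in> translation_defects G \<Longrightarrow> (\<lambda>x. a * v x) \<in> translation_defects G"
proof (induction rule: translation_defects.induct)
  case (defect g b)
  then have "(\<lambda>x. a * b x) \<in> bounded_functions G"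
    by (intro bounded_functions_closed) (simp add: bounded_functions_def)
  from defectI[OF defect(1) this] show ?case by (simp add: algebra_simps)
next
  case (add v w)
  from translation_defects.add[OF add.IH] show ?case by (simp add: algebra_simps)
next
  case (cong v w)
  from translation_defects.cong[OF cong.IH] cong.hyps show ?case by simp
qed

lemma (in group) translation_defects_zero: "(\<lambda>x. 0) \<in> translation_defects G"
  using translation_defects_scale[OF defectI[OF one_closed bounded_functions_closed(1)], of 0]
  by simp

lemma (in group) translation_defects_sum:
  "(\<And>i. i \<in> I \<Longrightarrow> v i \<in> translation_defects G) \<Longrightarrow> (\<lambda>x. \<Sum>i\<in>I. v i x) \<in> translation_defects G"
  by (induction I rule: infinite_finite_induct)
     (auto intro: translation_defects.add translation_defects_zero)

text \<open>
  The difference between a bounded function and its translate is itself a defect, so the translate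
  of a defect \<open>v\<close> differs from \<open>v\<close> by a defect.
\<close>

lemma (in group) translation_defects_translate:
  assumes v: "v \<in> translation_defects G" and g: "g \<in> carrier G"
  shows "(\<lambda>x. v (inv g \<otimes> x)) \<in> translation_defects G"
proof -
  have "(\<lambda>x. v x + (-1) * (v x - v (inv g \<otimes> x))) \<in> translation_defects G"
    by (intro translation_defects.add translation_defects_scale v defectI g
        translation_defects_bounded)
  then show ?thesis by simp
qed

lemma restrict_in_ell_inf: "restrict f (carrier G) \<in> ell_inf G \<longleftrightarrow> f \<in> bounded_functions G"
  by (simp add: ell_inf_def bounded_functions_def cong: image_cong_simp)

text \<open>
  The mean is specified on functions that are extensional on the carrier.  These rules carry its
  properties over to all functions that are bounded on the carrier.
\<close>

lemma (in group) invariant_meanD: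
  assumes "invariant_mean G m" and f: "f \<in> bounded_functions G"
  shows "h \<in> bounded_functions G \<Longrightarrow> m (\<lambda>x\<in>carrier G. f x + h x) =
      m (restrict f (carrier G)) + m (restrict h (carrier G))" (is "_ \<Longrightarrow> ?add")
    and "m (\<lambda>x\<in>carrier G. a * f x) = a * m (restrict f (carrier G))" (is ?scale)
    and "(\<And>x. x \<in> carrier G \<Longrightarrow> f x \<ge> 0) \<Longrightarrow> m (restrict f (carrier G)) \<ge> 0"
    and "g \<in> carrier G \<Longrightarrow>
      m (\<lambda>x\<in>carrier G. f (inv g \<otimes> x)) = m (restrict f (carrier G))" (is "_ \<Longrightarrow> ?trans")
proof -
  let ?f = "restrict f (carrier G)"
  note m = assms(1)[unfolded invariant_mean_def]
  have f': "?f \<in> ell_inf G" using f by (simp add: restrict_in_ell_inf)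
  show ?add if "h \<in> bounded_functions G"
  proof -
    let ?h = "restrict h (carrier G)"
    have "m (\<lambda>x\<in>carrier G. ?f x + ?h x) = m ?f + m ?h"
      using m f' that by (simp add: restrict_in_ell_inf del: restrict_apply)
    moreover have "(\<lambda>x\<in>carrier G. ?f x + ?h x) = (\<lambda>x\<in>carrier G. f x + h x)" by auto
    ultimately show ?add by metis
  qed
  have "m (\<lambda>x\<in>carrier G. a * ?f x) = a * m ?f"
    using m f' by (simp del: restrict_apply)
  moreover have "(\<lambda>x\<in>carrier G. a * ?f x) = (\<lambda>x\<in>carrier G. a * f x)" by auto
  ultimately show ?scale by metis
  show "m ?f \<ge> 0" if "\<And>x. x \<in> carrier G \<Longrightarrow> f x \<ge> 0" using m f' that by simp
  show ?trans if g: "g \<in> carrier G"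
  proof -
    have "m (left_translate G g ?f) = m ?f" using m f' g by blast
    moreover have "left_translate G g ?f = (\<lambda>x\<in>carrier G. f (inv g \<otimes> x))"
      using g by (auto simp: left_translate_def)
    ultimately show ?trans by metis
  qed
qed

lemma (in group) invariant_mean_vanishes_on_defects:
  assumes m: "invariant_mean G m"
  shows "v \<in> translation_defects G \<Longrightarrow> m (restrict v (carrier G)) = 0"
proof (induction rule: translation_defects.induct)
  case (defect g b)
  then have b: "b \<in> bounded_functions G" by (simp add: bounded_functions_def)
  have t: "(\<lambda>x. b (inv g \<otimes> x)) \<in> bounded_functions G"
    using defect by (intro bounded_functions_translate b) simp
  show ?case
    using invariant_meanD(1)[OF m b bounded_functions_closed(3)[OF t, of "-1"]]
      invariant_meanD(2)[OF m t, of "-1"] invariant_meanD(4)[OF m b defect(1)]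
    by (simp del: restrict_apply)
next
  case (add v w)
  then show ?case using invariant_meanD(1)[OF m] translation_defects_bounded
    by (simp del: restrict_apply)
next
  case (cong v w)
  then show ?case by (metis restrict_ext)
qed

lemma (in group) not_amenable_if_positive_defect:
  assumes v: "v \<in> translation_defects G" and ge: "\<And>x. x \<in> carrier G \<Longrightarrow> v x \<ge> 1"
  shows "\<not> amenable G"
proof
  assume "amenable G"
  then obtain m where m: "invariant_mean G m" by (auto simp: amenable_def)
  note bv = translation_defects_bounded[OF v]
  have one: "(\<lambda>x. 1) \<in> bounded_functions G" by (rule bounded_functionsI[of _ _ 1]) simp
  note mone = bounded_functions_closed(3)[OF one, of "-1"]
  have "0 \<le> m (\<lambda>x\<in>carrier G. v x + (-1) * 1)"
    using ge by (intro invariant_meanD(3)[OF m] bounded_functions_closed(2) bv mone) fastforce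
  also have "\<dots> = m (restrict v (carrier G)) + (-1) * m (\<lambda>x\<in>carrier G. 1)"
    using invariant_meanD(1)[OF m bv mone] invariant_meanD(2)[OF m one, of "-1"] by simp
  also have "\<dots> = -1"
    using m invariant_mean_vanishes_on_defects[OF m v] by (simp add: invariant_mean_def)
  finally show False by simp
qed

text \<open>
  If no defect is bounded below by 1, then every defect has a value below 1, and, since defects can
  be negated, also a value above -1.  Hence \<open>inf sup (f + v)\<close>, over all defects \<open>v\<close>, is
  finite.  A linear functional below it is at most every upper bound of its argument, hence
  positive and normalised, and it vanishes on defects, hence invariant.
\<close>

lemma (in group) positive_defect_if_not_amenable:
  assumes "\<not> amenable G"
  obtains v where "v \<in> translation_defects G" "\<And>x. x \<in> carrier G \<Longrightarrow> v x \<ge> 1"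
proof (rule ccontr)
  assume none: "\<not> thesis"
  note found = that
  let ?V = "bounded_functions G"
  \<comment> \<open>\<open>U f\<close> collects the upper bounds of all \<open>f + v\<close>, so its infimum is \<open>inf sup (f + v)\<close>\<close>
  define U where "U f = {t. \<exists>v\<in>translation_defects G. \<forall>x\<in>carrier G. f x + v x \<le> t}" for f
  define p where "p f = Inf (U f)" for f
  have small: "\<exists>x\<in>carrier G. v x < 1" if v: "v \<in> translation_defects G" for v
  proof (rule ccontr)
    assume "\<not> ?thesis"
    then have "v x \<ge> 1" if "x \<in> carrier G" for x using that by force
    then show False using found[OF v] none by blast
  qed
  have U_ge: "- B - 1 \<le> t" if t: "t \<in> U f" and B: "\<And>x. x \<in> carrier G \<Longrightarrow> \<bar>f x\<bar> \<le> B" for f t B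
  proof -
    obtain v where v: "v \<in> translation_defects G" "\<forall>x\<in>carrier G. f x + v x \<le> t"
      using t by (auto simp: U_def)
    obtain x where "x \<in> carrier G" "(-1) * v x < 1"
      using small[OF translation_defects_scale[OF v(1), of "-1"]] by blast
    then show ?thesis using v(2) B[of x] by (smt (verit))
  qed
  have U_zero: "t \<in> U f" if "\<And>x. x \<in> carrier G \<Longrightarrow> f x \<le> t" for f t
    unfolding U_def using that translation_defects_zero by (auto intro!: bexI[of _ "\<lambda>x. 0"])
  have bdd: "bdd_below (U f)" if "f \<in> ?V" for f
  proof -
    obtain B where "\<And>x. x \<in> carrier G \<Longrightarrow> \<bar>f x\<bar> \<le> B" using \<open>f \<in> ?V\<close> by (metis bounded_functionsE)
    then show ?thesis by (intro bdd_belowI[of _ "- B - 1"] U_ge)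
  qed
  have ne: "U f \<noteq> {}" if "f \<in> ?V" for f
  proof -
    obtain B where "\<And>x. x \<in> carrier G \<Longrightarrow> \<bar>f x\<bar> \<le> B" using \<open>f \<in> ?V\<close> by (metis bounded_functionsE)
    then have "B \<in> U f" by (intro U_zero) (rule abs_le_D1)
    then show ?thesis by blast
  qed
  have p_le: "p f \<le> t" if "f \<in> ?V" "t \<in> U f" for f t
    unfolding p_def using that by (intro cInf_lower bdd)
  have p_ge: "y \<le> p f" if "f \<in> ?V" "\<And>t. t \<in> U f \<Longrightarrow> y \<le> t" for y f
    unfolding p_def using that by (intro cInf_greatest ne)
  have "sublinear_on ?V p"
    unfolding sublinear_on_def
  proof (intro conjI ballI allI impI)
    fix f h assume f: "f \<in> ?V" and h: "h \<in> ?V"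
    have "p (\<lambda>x. f x + h x) \<le> s + t" if s: "s \<in> U f" and t: "t \<in> U h" for s t
    proof (rule p_le[OF bounded_functions_closed(2)[OF f h]])
      obtain v w where v: "v \<in> translation_defects G" "\<forall>x\<in>carrier G. f x + v x \<le> s"
        and w: "w \<in> translation_defects G" "\<forall>x\<in>carrier G. h x + w x \<le> t"
        using s t by (auto simp: U_def)
      have "\<forall>x\<in>carrier G. (f x + h x) + (v x + w x) \<le> s + t"
        using v(2) w(2) by (smt (verit))
      then show "s + t \<in> U (\<lambda>x. f x + h x)"
        unfolding U_def using translation_defects.add[OF v(1) w(1)]
        by (intro CollectI bexI[of _ "\<lambda>x. v x + w x"])
    qed
    then have "p (\<lambda>x. f x + h x) - s \<le> p h" if "s \<in> U f" for s
      using that by (intro p_ge h) (metis add.commute diff_le_eq)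
    then have "p (\<lambda>x. f x + h x) - p h \<le> p f"
      by (intro p_ge f) (metis add.commute diff_le_eq)
    then show "p (\<lambda>x. f x + h x) \<le> p f + p h" by simp
  next
    fix a :: real and f assume a: "a > 0" and f: "f \<in> ?V"
    have "p (\<lambda>x. a * f x) / a \<le> t" if t: "t \<in> U f" for t
    proof -
      obtain v where v: "v \<in> translation_defects G" "\<forall>x\<in>carrier G. f x + v x \<le> t"
        using t by (auto simp: U_def)
      have "\<forall>x\<in>carrier G. a * f x + a * v x \<le> a * t"
        using v(2) a by (simp flip: distrib_left)
      then have "a * t \<in> U (\<lambda>x. a * f x)"
        unfolding U_def using translation_defects_scale[OF v(1), of a]
        by (intro CollectI bexI[of _ "\<lambda>x. a * v x"])
      then have "p (\<lambda>x. a * f x) \<le> a * t" by (intro p_le bounded_functions_closed f)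
      then show ?thesis using a by (simp add: field_simps)
    qed
    then have "p (\<lambda>x. a * f x) / a \<le> p f" by (intro p_ge f)
    then show "p (\<lambda>x. a * f x) \<le> a * p f" using a by (simp add: field_simps)
  qed
  then obtain m where m_add: "\<And>f h. f \<in> ?V \<Longrightarrow> h \<in> ?V \<Longrightarrow> m (\<lambda>x. f x + h x) = m f + m h"
    and m_scale: "\<And>a f. f \<in> ?V \<Longrightarrow> m (\<lambda>x. a * f x) = a * m f"
    and m_le: "\<And>f. f \<in> ?V \<Longrightarrow> m f \<le> p f"
    by (rule linear_functional_below_sublinear[OF function_space_bounded_functions]) blast
  have m_upper: "m f \<le> t" if "f \<in> ?V" "\<And>x. x \<in> carrier G \<Longrightarrow> f x \<le> t" for f t
    using m_le[OF that(1)] p_le[OF that(1) U_zero[OF that(2)]] by linarith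
  have m_defect: "m v \<le> 0" if v: "v \<in> translation_defects G" for v
  proof -
    note bv = translation_defects_bounded[OF v]
    have "0 \<in> U v" unfolding U_def
      using translation_defects_scale[OF v, of "-1"] by (auto intro!: bexI[of _ "\<lambda>x. - v x"])
    then show ?thesis using m_le[OF bv] p_le[OF bv] by (meson order.trans)
  qed
  have m_defect0: "m v = 0" if v: "v \<in> translation_defects G" for v
    using m_defect[OF v] m_defect[OF translation_defects_scale[OF v, of "-1"]]
      m_scale[OF translation_defects_bounded[OF v], of "-1"] by simp
  have m_diff: "m f = m h" if f: "f \<in> ?V" and h: "h \<in> ?V"
    and d: "(\<lambda>x. f x - h x) \<in> translation_defects G" for f h
  proof -
    have "m (\<lambda>x. f x + (-1) * h x) = m f + (-1) * m h"
      using m_add[OF f bounded_functions_closed(3)[OF h, of "-1"]] m_scale[OF h, of "-1"] by simp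
    then show ?thesis using m_defect0[OF d] by simp
  qed
  have m_cong: "m f = m h" if "f \<in> ?V" "h \<in> ?V" "\<And>x. x \<in> carrier G \<Longrightarrow> f x = h x" for f h
    using that translation_defects.cong[OF translation_defects_zero, of "\<lambda>x. f x - h x"]
    by (intro m_diff) auto
  have ell: "f \<in> ?V" if "f \<in> ell_inf G" for f
    using that by (simp add: ell_inf_def bounded_functions_def)
  have restr: "restrict f (carrier G) \<in> ?V" if "f \<in> ?V" for f
    using that by (auto simp: bounded_functions_def cong: image_cong_simp)
  have m_restrict: "m (restrict f (carrier G)) = m f" if "f \<in> ?V" for f
    using that by (intro m_cong restr) auto
  have const: "(\<lambda>x. c) \<in> ?V" for c :: real by (rule bounded_functionsI[of _ _ "\<bar>c\<bar>"]) simp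
  have "invariant_mean G m"
    unfolding invariant_mean_def
  proof (intro conjI ballI allI impI)
    fix f h assume "f \<in> ell_inf G" "h \<in> ell_inf G"
    then show "m (\<lambda>x\<in>carrier G. f x + h x) = m f + m h"
      by (simp add: m_restrict m_add ell bounded_functions_closed)
  next
    fix a f assume "f \<in> ell_inf G"
    then show "m (\<lambda>x\<in>carrier G. a * f x) = a * m f"
      by (simp add: m_restrict m_scale ell bounded_functions_closed)
  next
    fix f assume f: "f \<in> ell_inf G" and "\<forall>x\<in>carrier G. f x \<ge> 0"
    then have "m (\<lambda>x. (-1) * f x) \<le> 0"
      by (intro m_upper bounded_functions_closed ell f) simp
    then show "0 \<le> m f" using m_scale[OF ell[OF f], of "-1"] by simp
  next
    have "m (\<lambda>x. 1) \<le> 1" "m (\<lambda>x. (-1) * 1) \<le> -1"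
      by (intro m_upper const; simp)+
    then have "m (\<lambda>x. 1) = 1" using m_scale[OF const, of "-1" 1] by simp
    then show "m (\<lambda>x\<in>carrier G. 1) = 1" by (simp add: m_restrict const)
  next
    fix g f assume g: "g \<in> carrier G" and f: "f \<in> ell_inf G"
    have t: "(\<lambda>x. f (inv g \<otimes> x)) \<in> ?V"
      using g by (intro bounded_functions_translate ell f) simp
    have "m (left_translate G g f) = m (\<lambda>x. f (inv g \<otimes> x))"
      unfolding left_translate_def by (rule m_restrict[OF t])
    also have "\<dots> = m f"
      using m_diff[OF ell[OF f] t defectI[OF g ell[OF f]]] by simp
    finally show "m (left_translate G g f) = m f" .
  qed
  then show False using assms by (auto simp: amenable_def)
qed


section \<open>Exhaustion by compact sets and locally finite sums\<close>

lemma sigma_compact_space: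
  assumes "locally_compact_space (euclidean :: 'x::second_countable_topology topology)"
  obtains \<K> :: "'x::second_countable_topology set set"
    where "countable \<K>" "\<And>K. K \<in> \<K> \<Longrightarrow> compact K" "\<Union>\<K> = UNIV"
proof -
  have "\<forall>x::'x. \<exists>U K. open U \<and> compact K \<and> x \<in> U \<and> U \<subseteq> K"
    using assms by (simp add: locally_compact_space_def)
  then obtain U K :: "'x \<Rightarrow> 'x set"
    where UK: "\<And>x. open (U x)" "\<And>x. compact (K x)" "\<And>x. x \<in> U x" "\<And>x. U x \<subseteq> K x" by metis
  obtain F where F: "F \<subseteq> range U" "countable F" "\<Union>F = \<Union>(range U)"
    using Lindelof[of "range U"] UK by blast
  then obtain X where X: "countable X" "F = U ` X"
    by (metis countable_subset_image)
  show thesis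
  proof (rule that[of "K ` X"])
    show "countable (K ` X)" using X(1) by (rule countable_image)
    show "compact L" if "L \<in> K ` X" for L using that UK(2) by blast
    have "UNIV \<subseteq> \<Union>(U ` X)" using UK(3) F(3) unfolding X(2) by blast
    then show "\<Union>(K ` X) = UNIV" using UK(4) by blast
  qed
qed

text \<open>
  The sum is an integral against counting measure on the index set, which turns measurability
  into a statement about integrals depending on a parameter.
\<close>

lemma borel_measurable_locally_finite_sum:
  fixes a :: "'i \<Rightarrow> real"
  assumes I: "countable I" and A: "\<And>i. i \<in> I \<Longrightarrow> A i \<in> sets M"
    and fin: "\<And>x. x \<in> space M \<Longrightarrow> finite {i \<in> I. x \<in> A i}"
  shows "(\<lambda>x. \<Sum>i | i \<in> I \<and> x \<in> A i. a i) \<in> borel_measurable M"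
proof -
  interpret sigma_finite_measure "count_space I"
    by (rule sigma_finite_measure_count_space_countable[OF I])
  have "(\<lambda>(i, x). a i * indicator (A i) x) \<in> borel_measurable (count_space I \<Otimes>\<^sub>M M)"
    using A by (intro measurable_pair_measure_countable1 I) (auto intro!: borel_measurable_times)
  from measurable_compose[OF measurable_pair_swap' this]
  have "(\<lambda>x. LINT i|count_space I. a i * indicator (A i) x) \<in> borel_measurable M"
    by (intro borel_measurable_lebesgue_integral) (simp add: case_prod_beta')
  moreover have "(LINT i|count_space I. a i * indicator (A i) x) = (\<Sum>i | i \<in> I \<and> x \<in> A i. a i)"
    if x: "x \<in> space M" for x
  proof -
    have "finite {i \<in> I. a i * indicator (A i) x \<noteq> 0}"
      by (rule finite_subset[OF _ fin[OF x]]) (auto simp: indicator_def)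
    then have "(LINT i|count_space I. a i * indicator (A i) x) =
        (\<Sum>i | i \<in> I \<and> a i * indicator (A i) x \<noteq> 0. a i * indicator (A i) x)"
      by (rule lebesgue_integral_count_space_finite_support)
    also have "\<dots> = (\<Sum>i | i \<in> I \<and> x \<in> A i. a i)"
      by (rule sum.mono_neutral_cong_left[OF fin[OF x]]) (auto simp: indicator_def)
    finally show ?thesis .
  qed
  ultimately show ?thesis by (simp cong: measurable_cong)
qed

lemma integrable_indicator_times_ess_bounded:
  fixes f :: "'a \<Rightarrow> real"
  assumes "A \<in> sets M" "emeasure M A < \<infinity>" "f \<in> borel_measurable M" "AE x in M. \<bar>f x\<bar> \<le> B"
  shows "integrable M (\<lambda>x. indicator A x * f x)"
proof -
  have "AE x in M. x \<in> A \<longrightarrow> norm (f x) \<le> B" using assms(4) by eventually_elim simp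
  then have "integrable M (\<lambda>x. indicator A x *\<^sub>R f x)"
    by (rule integrableI_bounded_set_indicator[OF assms(1,3,2)])
  then show ?thesis by simp
qed

text \<open>
  The sets \<open>R i\<close> need only cover the part of \<open>Z\<close> on which \<open>c\<close> is nonzero; \<open>Z\<close> itself may have infinite
  measure, as a strip \<open>A \<times> UNIV\<close> does.
\<close>

lemma integral_finite_partition:
  fixes c :: "'a \<Rightarrow> real"
  assumes c: "c \<in> borel_measurable M" and bound: "AE p in M. \<bar>c p\<bar> \<le> B"
    and Z: "Z \<in> sets M" and P: "finite P"
    and R: "\<And>i. i \<in> P \<Longrightarrow> R i \<in> sets M" "\<And>i. i \<in> P \<Longrightarrow> emeasure M (R i) < \<infinity>"
      "\<And>i. i \<in> P \<Longrightarrow> R i \<subseteq> Z" "disjoint_family_on R P"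
    and supp: "AE p in M. p \<in> Z \<longrightarrow> c p \<noteq> 0 \<longrightarrow> p \<in> (\<Union>i\<in>P. R i)"
  shows "integrable M (\<lambda>p. indicator Z p * c p)"
    and "(LINT p|M. indicator Z p * c p) = (\<Sum>i\<in>P. LINT p|M. indicator (R i) p * c p)"
proof -
  have int: "integrable M (\<lambda>p. indicator (R i) p * c p)" if "i \<in> P" for i
    by (rule integrable_indicator_times_ess_bounded[OF R(1)[OF that] R(2)[OF that] c bound])
  have sum: "integrable M (\<lambda>p. \<Sum>i\<in>P. indicator (R i) p * c p)"
    by (intro Bochner_Integration.integrable_sum int)
  have eq: "AE p in M. indicator Z p * c p = (\<Sum>i\<in>P. indicator (R i) p * c p)"
    using supp
  proof eventually_elim
    case (elim p)
    have "(\<Sum>i\<in>P. indicator (R i) p * c p) = indicator (\<Union>i\<in>P. R i) p * c p"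
      by (simp only: indicator_UN_disjoint[OF P R(4)] sum_distrib_right)
    also have "\<dots> = indicator Z p * c p"
      using elim R(3) by (auto simp: indicator_def)
    finally show ?case by simp
  qed
  have meas: "(\<lambda>p. indicator Z p * c p) \<in> borel_measurable M"
    by (intro borel_measurable_times borel_measurable_indicator Z c)
  show "integrable M (\<lambda>p. indicator Z p * c p)"
    using sum eq meas borel_measurable_integrable[OF sum] by (subst integrable_cong_AE)
  have "(LINT p|M. indicator Z p * c p) = (LINT p|M. (\<Sum>i\<in>P. indicator (R i) p * c p))"
    using eq meas borel_measurable_integrable[OF sum] by (intro integral_cong_AE)
  also have "\<dots> = (\<Sum>i\<in>P. LINT p|M. indicator (R i) p * c p)"
    by (intro Bochner_Integration.integral_sum int)
  finally show "(LINT p|M. indicator Z p * c p) = (\<Sum>i\<in>P. LINT p|M. indicator (R i) p * c p)" .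
qed


section \<open>Tiles of a proper cocompact action\<close>

locale measured_cocompact_action = group G for G :: "('g, 'b) monoid_scheme" (structure) +
  fixes \<phi> :: "'g \<Rightarrow> 'x::{second_countable_topology, t2_space} \<Rightarrow> 'x"
    and \<mu> :: "'x measure" and S :: "'x set"
  assumes locally_compact: "locally_compact_space (euclidean :: 'x topology)"
    and action: "continuous_action G \<phi>"
    and proper: "proper_action G \<phi>"
    and compact_S: "compact S"
    and cover: "(\<Union>g\<in>carrier G. \<phi> g ` S) = UNIV"
    and regular: "regular_measure \<mu>"
    and invariant: "invariant_measure G \<phi> \<mu>"
    and nonzero: "emeasure \<mu> UNIV \<noteq> 0"
begin

abbreviation tile :: "'g \<Rightarrow> 'x set" where "tile g \<equiv> \<phi> g ` S"

lemma group_action: "group_action G UNIV \<phi>"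
  using action by (simp add: continuous_action_def)

lemma act_mult: "g \<in> carrier G \<Longrightarrow> h \<in> carrier G \<Longrightarrow> \<phi> (g \<otimes> h) x = \<phi> g (\<phi> h x)"
  by (rule group_action.composition_rule[OF group_action UNIV_I])

lemma act_one: "\<phi> \<one> x = x"
  by (metis group_action.id_eq_one[OF group_action] restrict_apply UNIV_I)

lemma image_act_mult:
  "g \<in> carrier G \<Longrightarrow> h \<in> carrier G \<Longrightarrow> \<phi> (g \<otimes> h) ` A = \<phi> g ` \<phi> h ` A"
  by (simp add: act_mult image_image)

lemma in_image_act_iff: "g \<in> carrier G \<Longrightarrow> x \<in> \<phi> g ` A \<longleftrightarrow> \<phi> (inv g) x \<in> A"
proof
  assume g: "g \<in> carrier G" and "\<phi> (inv g) x \<in> A"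
  moreover have "x = \<phi> g (\<phi> (inv g) x)" using g by (simp flip: act_mult add: act_one)
  ultimately show "x \<in> \<phi> g ` A" by blast
next
  assume g: "g \<in> carrier G" and "x \<in> \<phi> g ` A"
  then show "\<phi> (inv g) x \<in> A" by (auto simp flip: act_mult simp: act_one)
qed

lemma compact_image_act:
  assumes "g \<in> carrier G" "compact K"
  shows "compact (\<phi> g ` K)"
proof (rule compact_continuous_image[OF _ assms(2)])
  have "continuous_on UNIV (\<phi> g)" using action assms by (simp add: continuous_action_def)
  then show "continuous_on K (\<phi> g)" by (rule continuous_on_subset) simp
qed

lemma finite_meeting:
  assumes "compact K" "compact L"
  shows "finite {g \<in> carrier G. \<phi> g ` K \<inter> L \<noteq> {}}"
proof (rule finite_subset)
  show "finite (meeting_set G \<phi> (K \<union> L))"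
    using proper assms by (simp add: proper_action_def compact_Un)
  show "{g \<in> carrier G. \<phi> g ` K \<inter> L \<noteq> {}} \<subseteq> meeting_set G \<phi> (K \<union> L)"
    by (auto simp: meeting_set_def)
qed

lemma finite_tiles_meeting: "compact L \<Longrightarrow> finite {g \<in> carrier G. tile g \<inter> L \<noteq> {}}"
  by (rule finite_meeting[OF compact_S])

lemma finite_tiles_at: "finite {g \<in> carrier G. x \<in> tile g}"
  using finite_tiles_meeting[of "{x}"] by simp

lemma tile_at: obtains g where "g \<in> carrier G" "x \<in> tile g"
  using cover by blast

text \<open>
  Each group element moves a fixed point into one of countably many compact sets, and by properness
  only finitely many elements move it into any given one.
\<close>

lemma countable_carrier: "countable (carrier G)"
proof -
  obtain \<K> :: "'x set set" where K: "countable \<K>" "\<And>K. K \<in> \<K> \<Longrightarrow> compact K" "\<Union>\<K> = UNIV"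
    using sigma_compact_space[OF locally_compact] by blast
  obtain x :: 'x where True by blast
  have "carrier G \<subseteq> (\<Union>K\<in>\<K>. {g \<in> carrier G. \<phi> g ` {x} \<inter> K \<noteq> {}})" using K(3) by fastforce
  moreover have "countable (\<Union>K\<in>\<K>. {g \<in> carrier G. \<phi> g ` {x} \<inter> K \<noteq> {}})"
    using K by (intro countable_UN[OF K(1)] countable_finite finite_meeting) auto
  ultimately show ?thesis by (rule countable_subset)
qed

lemma sets_mu [measurable_cong, simp]: "sets \<mu> = sets borel"
  using regular unfolding regular_measure_def by (rule conjunct1)

lemma space_mu [simp]: "space \<mu> = UNIV"
  using sets_eq_imp_space_eq[OF sets_mu] by simp

lemma compact_sets: "compact K \<Longrightarrow> K \<in> sets \<mu>"
  unfolding sets_mu by (intro borel_closed compact_imp_closed)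

lemma finite_compact: "compact K \<Longrightarrow> emeasure \<mu> K < \<infinity>"
  using regular unfolding regular_measure_def by simp

lemma tile_sets: "g \<in> carrier G \<Longrightarrow> tile g \<in> sets \<mu>"
  by (intro compact_sets compact_image_act compact_S)

lemma emeasure_tile: "g \<in> carrier G \<Longrightarrow> emeasure \<mu> (tile g) = emeasure \<mu> S"
  using invariant compact_sets[OF compact_S] unfolding invariant_measure_def by blast

lemma emeasure_tile_finite: "g \<in> carrier G \<Longrightarrow> emeasure \<mu> (tile g) < \<infinity>"
  by (intro finite_compact compact_image_act compact_S)

lemma measure_tile: "g \<in> carrier G \<Longrightarrow> measure \<mu> (tile g) = measure \<mu> S"
  unfolding measure_def by (simp only: emeasure_tile)

sublocale sigma_finite_measure \<mu>
proof
  obtain \<K> :: "'x set set" where K: "countable \<K>" "\<And>K. K \<in> \<K> \<Longrightarrow> compact K" "\<Union>\<K> = UNIV"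
    using sigma_compact_space[OF locally_compact] by blast
  show "\<exists>A. countable A \<and> A \<subseteq> sets \<mu> \<and> \<Union> A = space \<mu> \<and> (\<forall>a\<in>A. emeasure \<mu> a \<noteq> \<infinity>)"
  proof (intro exI conjI)
    show "\<K> \<subseteq> sets \<mu>" using K(2) compact_sets by blast
    show "\<forall>a\<in>\<K>. emeasure \<mu> a \<noteq> \<infinity>" using K(2) finite_compact by fastforce
    show "\<Union>\<K> = space \<mu>" using K(3) by simp
  qed (rule K(1))
qed

text \<open>
  Countably many translates of \<open>S\<close>, all of the same measure, cover a space of nonzero measure.
\<close>

lemma measure_S_pos: "0 < measure \<mu> S"
proof (rule ccontr)
  assume "\<not> 0 < measure \<mu> S"
  then have "measure \<mu> S = 0" using measure_nonneg[of \<mu> S] by linarith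
  moreover have "emeasure \<mu> S = ennreal (measure \<mu> S)"
    using finite_compact[OF compact_S] by (intro emeasure_eq_ennreal_measure) simp
  ultimately have "emeasure \<mu> S = 0" by (metis ennreal_0)
  then have "(\<Union>g\<in>carrier G. tile g) \<in> null_sets \<mu>"
    by (intro null_sets_UN' countable_carrier null_setsI tile_sets) (simp_all add: emeasure_tile)
  then show False using nonzero cover by (simp add: null_setsD1)
qed

text \<open>
  The bound is uniform in the point: translating by the inverse of one tile index \<open>h\<close> at \<open>x\<close> maps all
  other indices at \<open>x\<close> into the set of elements moving \<open>S\<close> to a set that meets \<open>S\<close>.
\<close>

lemma card_tiles_at_le: "card {g \<in> carrier G. x \<in> tile g} \<le> card (meeting_set G \<phi> S)"
proof -
  obtain h where h: "h \<in> carrier G" "x \<in> tile h" by (rule tile_at)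
  show ?thesis
  proof (rule card_inj_on_le)
    show "inj_on (\<lambda>g. inv h \<otimes> g) {g \<in> carrier G. x \<in> tile g}"
      using h by (auto simp: inj_on_def)
    show "finite (meeting_set G \<phi> S)"
      using proper compact_S by (simp add: proper_action_def)
    show "(\<lambda>g. inv h \<otimes> g) ` {g \<in> carrier G. x \<in> tile g} \<subseteq> meeting_set G \<phi> S"
    proof (rule image_subsetI)
      fix g assume "g \<in> {g \<in> carrier G. x \<in> tile g}"
      then have g: "g \<in> carrier G" "x \<in> tile g" by simp_all
      have "\<phi> (inv h) x \<in> \<phi> (inv h \<otimes> g) ` S"
        using h g by (simp add: image_act_mult)
      moreover have "\<phi> (inv h) x \<in> S" using h in_image_act_iff by blast
      ultimately show "inv h \<otimes> g \<in> meeting_set G \<phi> S"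
        using h g by (auto simp: meeting_set_def)
    qed
  qed
qed

lemma sum_tiles_at_bound:
  assumes a: "\<And>g. g \<in> carrier G \<Longrightarrow> \<bar>a g\<bar> \<le> B" and "B \<ge> 0"
    and sub: "J \<subseteq> {g \<in> carrier G. x \<in> tile g}"
  shows "\<bar>\<Sum>g\<in>J. a g\<bar> \<le> real (card (meeting_set G \<phi> S)) * B"
proof -
  have "\<bar>\<Sum>g\<in>J. a g\<bar> \<le> (\<Sum>g\<in>J. \<bar>a g\<bar>)" by (rule sum_abs)
  also have "\<dots> \<le> real (card J) * B" by (rule sum_bounded_above) (use a sub in auto)
  also have "\<dots> \<le> real (card (meeting_set G \<phi> S)) * B"
    using card_mono[OF finite_tiles_at sub] card_tiles_at_le[of x] \<open>B \<ge> 0\<close>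
    by (intro mult_right_mono) auto
  finally show ?thesis .
qed

lemma tile_combination:
  assumes "finite J" and t: "\<And>i. i \<in> J \<Longrightarrow> t i \<in> carrier G"
  shows "integrable \<mu> (\<lambda>y. \<Sum>i\<in>J. a i * indicator (tile (t i)) y)"
    and "(LINT y|\<mu>. (\<Sum>i\<in>J. a i * indicator (tile (t i)) y)) = measure \<mu> S * (\<Sum>i\<in>J. a i)"
proof -
  have int: "integrable \<mu> (indicator (tile (t i)) :: 'x \<Rightarrow> real)" if "i \<in> J" for i
    using t[OF that] emeasure_tile_finite tile_sets by (intro integrable_real_indicator) auto
  show "integrable \<mu> (\<lambda>y. \<Sum>i\<in>J. a i * indicator (tile (t i)) y)"
    by (intro Bochner_Integration.integrable_sum integrable_mult_right int)
  have "(LINT y|\<mu>. (\<Sum>i\<in>J. a i * indicator (tile (t i)) y)) =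
      (\<Sum>i\<in>J. LINT y|\<mu>. a i * indicator (tile (t i)) y)"
    by (intro Bochner_Integration.integral_sum integrable_mult_right int)
  also have "\<dots> = (\<Sum>i\<in>J. a i * measure \<mu> S)"
    using t by (intro sum.cong) (auto simp: measure_tile)
  finally show "(LINT y|\<mu>. (\<Sum>i\<in>J. a i * indicator (tile (t i)) y)) = measure \<mu> S * (\<Sum>i\<in>J. a i)"
    by (metis mult.commute sum_distrib_right)
qed

lemma controlled_setsI:
  assumes "compact C"
    and "\<And>x y. (x, y) \<in> E \<Longrightarrow> \<exists>g\<in>carrier G. x \<in> \<phi> g ` C \<and> y \<in> \<phi> g ` C"
  shows "E \<in> controlled_sets G \<phi>"
proof -
  have "E \<subseteq> (\<Union>g\<in>carrier G. (\<phi> g ` C) \<times> (\<phi> g ` C))"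
  proof
    fix p assume "p \<in> E"
    then show "p \<in> (\<Union>g\<in>carrier G. (\<phi> g ` C) \<times> (\<phi> g ` C))"
      using assms(2)[of "fst p" "snd p"] by (simp add: mem_Times_iff)
  qed
  then show ?thesis using assms(1) unfolding controlled_sets_def by blast
qed

lemma controlled_setsE:
  assumes "E \<in> controlled_sets G \<phi>"
  obtains C where "compact C"
    "\<And>x y. (x, y) \<in> E \<Longrightarrow> \<exists>g\<in>carrier G. x \<in> \<phi> g ` C \<and> y \<in> \<phi> g ` C"
proof -
  obtain C where C: "compact C" "E \<subseteq> (\<Union>g\<in>carrier G. (\<phi> g ` C) \<times> (\<phi> g ` C))"
    using assms unfolding controlled_sets_def by blast
  have "\<exists>g\<in>carrier G. x \<in> \<phi> g ` C \<and> y \<in> \<phi> g ` C" if "(x, y) \<in> E" for x y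
    using subsetD[OF C(2) that] by simp
  then show thesis using that C(1) by metis
qed

lemma controlled_sets_Un:
  assumes "E \<in> controlled_sets G \<phi>" "F \<in> controlled_sets G \<phi>"
  shows "E \<union> F \<in> controlled_sets G \<phi>"
proof -
  obtain C where C: "compact C"
    "\<And>x y. (x, y) \<in> E \<Longrightarrow> \<exists>g\<in>carrier G. x \<in> \<phi> g ` C \<and> y \<in> \<phi> g ` C"
    using assms(1) by (rule controlled_setsE) blast
  obtain D where D: "compact D"
    "\<And>x y. (x, y) \<in> F \<Longrightarrow> \<exists>g\<in>carrier G. x \<in> \<phi> g ` D \<and> y \<in> \<phi> g ` D"
    using assms(2) by (rule controlled_setsE) blast
  show ?thesis
  proof (rule controlled_setsI[OF compact_Un[OF C(1) D(1)]])
    fix x y assume "(x, y) \<in> E \<union> F"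
    then consider "(x, y) \<in> E" | "(x, y) \<in> F" by blast
    then show "\<exists>g\<in>carrier G. x \<in> \<phi> g ` (C \<union> D) \<and> y \<in> \<phi> g ` (C \<union> D)"
      unfolding image_Un by cases (use C(2) D(2) in blast)+
  qed
qed

text \<open>
  In terms of tiles, controlled sets connect \<open>g\<close> only with the elements \<open>g p\<close> for \<open>p\<close> in a finite
  set \<open>P\<close>.  If \<open>x \<in> g S\<close> and \<open>y \<in> h S\<close> lie in a common translate \<open>k C\<close>, then with \<open>D = C \<union> S\<close> both
  \<open>g\<inverse> k\<close> and \<open>k\<inverse> h\<close> move \<open>D\<close> to a set meeting \<open>D\<close>, and \<open>g\<inverse> h\<close> is their product.
\<close>

lemma controlled_sets_section:
  assumes "E \<in> controlled_sets G \<phi>"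
  obtains P where "finite P" "P \<subseteq> carrier G" "\<And>p. p \<in> P \<Longrightarrow> inv p \<in> P"
    "\<And>g x y. g \<in> carrier G \<Longrightarrow> (x, y) \<in> E \<or> (y, x) \<in> E \<Longrightarrow> x \<in> tile g \<Longrightarrow>
      {h \<in> carrier G. y \<in> tile h} \<subseteq> (\<lambda>p. g \<otimes> p) ` P"
proof -
  obtain C where C: "compact C"
    "\<And>x y. (x, y) \<in> E \<Longrightarrow> \<exists>g\<in>carrier G. x \<in> \<phi> g ` C \<and> y \<in> \<phi> g ` C"
    using assms by (rule controlled_setsE) blast
  define D where "D = C \<union> S"
  define M where "M = meeting_set G \<phi> D"
  define P where "P = {k \<otimes> l | k l. k \<in> M \<and> l \<in> M}"
  have finM: "finite M"
    using proper C(1) compact_S by (simp add: M_def D_def proper_action_def compact_Un)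
  have M_in: "inv g \<otimes> k \<in> M" if "g \<in> carrier G" "k \<in> carrier G" "x \<in> \<phi> g ` D" "x \<in> \<phi> k ` D"
    for g k x
  proof -
    have "\<phi> (inv g) x \<in> \<phi> (inv g \<otimes> k) ` D" using that by (simp add: image_act_mult)
    moreover have "\<phi> (inv g) x \<in> D" using that in_image_act_iff by blast
    ultimately show ?thesis using that by (auto simp: M_def meeting_set_def)
  qed
  have M_inv: "inv k \<in> M" if kM: "k \<in> M" for k
  proof -
    have k: "k \<in> carrier G" using that by (simp add: M_def meeting_set_def)
    obtain x where "x \<in> D" "x \<in> \<phi> k ` D" using kM unfolding M_def meeting_set_def by blast
    then show ?thesis using M_in[of k \<one> x] k by (simp add: act_one)
  qed
  have Mc: "M \<subseteq> carrier G" by (auto simp: M_def meeting_set_def)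
  show thesis
  proof (rule that[of P])
    show "finite P" unfolding P_def using finM by (intro finite_image_set2) simp_all
    show "P \<subseteq> carrier G" unfolding P_def using Mc by auto
    show "inv p \<in> P" if "p \<in> P" for p
    proof -
      obtain k l where kl: "k \<in> M" "l \<in> M" "p = k \<otimes> l" using \<open>p \<in> P\<close> unfolding P_def by blast
      then have "inv p = inv l \<otimes> inv k" using Mc by (auto intro: inv_mult_group)
      then show ?thesis using M_inv kl unfolding P_def by blast
    qed
    fix g x y assume g: "g \<in> carrier G" and E: "(x, y) \<in> E \<or> (y, x) \<in> E" and x: "x \<in> tile g"
    obtain k where k: "k \<in> carrier G" "x \<in> \<phi> k ` C" "y \<in> \<phi> k ` C"
      using C(2)[of x y] C(2)[of y x] E by blast
    show "{h \<in> carrier G. y \<in> tile h} \<subseteq> (\<lambda>p. g \<otimes> p) ` P"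
    proof
      fix h assume "h \<in> {h \<in> carrier G. y \<in> tile h}"
      then have h: "h \<in> carrier G" "y \<in> tile h" by simp_all
      have "inv g \<otimes> k \<in> M" "inv k \<otimes> h \<in> M"
        using g k h x by (auto intro!: M_in[of g k x] M_in[of k h y] simp: D_def)
      then have "(inv g \<otimes> k) \<otimes> (inv k \<otimes> h) \<in> P" unfolding P_def by blast
      moreover have "h = g \<otimes> ((inv g \<otimes> k) \<otimes> (inv k \<otimes> h))"
        using g h k by (simp flip: m_assoc)
      ultimately show "h \<in> (\<lambda>p. g \<otimes> p) ` P" by blast
    qed
  qed
qed


lemma ess_boundedI:
  "f \<in> borel_measurable M \<Longrightarrow> (\<And>x. \<bar>f x\<bar> \<le> B) \<Longrightarrow> ess_bounded M f"
  unfolding ess_bounded_def by (intro conjI exI[of _ B] AE_I2)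

lemma one_chain_iff:
  "one_chain \<E> \<mu> c \<longleftrightarrow> ess_bounded (\<mu> \<Otimes>\<^sub>M \<mu>) c \<and>
    (\<exists>E \<in> \<E> \<inter> sets (\<mu> \<Otimes>\<^sub>M \<mu>). AE p in \<mu> \<Otimes>\<^sub>M \<mu>. p \<notin> E \<longrightarrow> c p = 0)"
proof -
  have "(\<integral>\<^sup>+p\<in>- E. ennreal \<bar>c p\<bar> \<partial>(\<mu> \<Otimes>\<^sub>M \<mu>)) = 0 \<longleftrightarrow> (AE p in \<mu> \<Otimes>\<^sub>M \<mu>. p \<notin> E \<longrightarrow> c p = 0)"
    if c[measurable]: "c \<in> borel_measurable (\<mu> \<Otimes>\<^sub>M \<mu>)" and E: "E \<in> sets (\<mu> \<Otimes>\<^sub>M \<mu>)" for E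
  proof -
    have [measurable]: "- E \<in> sets (\<mu> \<Otimes>\<^sub>M \<mu>)"
      using sets.compl_sets[OF E] by (simp add: space_pair_measure Compl_eq_Diff_UNIV)
    have "(\<integral>\<^sup>+p\<in>- E. ennreal \<bar>c p\<bar> \<partial>(\<mu> \<Otimes>\<^sub>M \<mu>)) = 0 \<longleftrightarrow>
        (AE p in \<mu> \<Otimes>\<^sub>M \<mu>. ennreal \<bar>c p\<bar> * indicator (- E) p = 0)"
      by (intro nn_integral_0_iff_AE) measurable
    also have "\<dots> \<longleftrightarrow> (AE p in \<mu> \<Otimes>\<^sub>M \<mu>. p \<notin> E \<longrightarrow> c p = 0)"
      by (intro AE_cong) (auto simp: indicator_def)
    finally show ?thesis .
  qed
  then show ?thesis unfolding one_chain_def ess_bounded_def by blast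
qed

section \<open>From a positive defect to a Ponzi scheme\<close>

lemma one_chain_add:
  assumes "one_chain (controlled_sets G \<phi>) \<mu> c" "one_chain (controlled_sets G \<phi>) \<mu> d"
  shows "one_chain (controlled_sets G \<phi>) \<mu> (\<lambda>p. c p + d p)"
proof -
  obtain A B E F where c: "c \<in> borel_measurable (\<mu> \<Otimes>\<^sub>M \<mu>)" "AE p in \<mu> \<Otimes>\<^sub>M \<mu>. \<bar>c p\<bar> \<le> A"
      "E \<in> controlled_sets G \<phi>" "E \<in> sets (\<mu> \<Otimes>\<^sub>M \<mu>)" "AE p in \<mu> \<Otimes>\<^sub>M \<mu>. p \<notin> E \<longrightarrow> c p = 0"
    and d: "d \<in> borel_measurable (\<mu> \<Otimes>\<^sub>M \<mu>)" "AE p in \<mu> \<Otimes>\<^sub>M \<mu>. \<bar>d p\<bar> \<le> B"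
      "F \<in> controlled_sets G \<phi>" "F \<in> sets (\<mu> \<Otimes>\<^sub>M \<mu>)" "AE p in \<mu> \<Otimes>\<^sub>M \<mu>. p \<notin> F \<longrightarrow> d p = 0"
    using assms unfolding one_chain_iff ess_bounded_def by auto
  have "AE p in \<mu> \<Otimes>\<^sub>M \<mu>. \<bar>c p + d p\<bar> \<le> A + B"
    using c(2) d(2) by eventually_elim linarith
  moreover have "AE p in \<mu> \<Otimes>\<^sub>M \<mu>. p \<notin> E \<union> F \<longrightarrow> c p + d p = 0"
    using c(5) d(5) by eventually_elim simp
  moreover have "E \<union> F \<in> controlled_sets G \<phi> \<inter> sets (\<mu> \<Otimes>\<^sub>M \<mu>)"
    using c d controlled_sets_Un by blast
  ultimately show ?thesis
    unfolding one_chain_iff ess_bounded_def using c(1) d(1) by (blast intro: borel_measurable_add)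
qed

text \<open>
  For the generator \<open>b x - b (h\<inverse> x)\<close> the chain is the sum, over \<open>g\<close>, of \<open>b (g\<inverse>)\<close> times the indicator
  of \<open>g h\<inverse> S \<times> g S\<close>.  Integrating out one variable replaces a tile by the constant \<open>\<mu> S\<close>; substituting
  \<open>g h\<close> for \<open>g\<close> in the outgoing part turns \<open>b (g\<inverse>)\<close> into \<open>b (h\<inverse> g\<inverse>)\<close>, which produces the defect at
  \<open>g\<inverse>\<close>.  Integrability of the sections is carried along to make the boundary additive.
\<close>

lemma defect_is_boundary:
  assumes "v \<in> translation_defects G"
  shows "\<exists>c. one_chain (controlled_sets G \<phi>) \<mu> c \<and>
    (\<forall>x. integrable \<mu> (\<lambda>y. c (x, y))) \<and> (\<forall>x. integrable \<mu> (\<lambda>y. c (y, x))) \<and>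
    (\<forall>x. boundary \<mu> c x = measure \<mu> S * (\<Sum>g | g \<in> carrier G \<and> x \<in> tile g. v (inv g)))"
  using assms
proof (induction rule: translation_defects.induct)
  case (defect h b)
  have h: "h \<in> carrier G" by fact
  define A where "A g = tile (g \<otimes> inv h) \<times> tile g" for g
  define c where "c p = (\<Sum>g | g \<in> carrier G \<and> p \<in> A g. b (inv g))" for p
  have A_sets: "A g \<in> sets (\<mu> \<Otimes>\<^sub>M \<mu>)" if "g \<in> carrier G" for g
    using that h unfolding A_def by (intro pair_measureI tile_sets) auto
  have A_sub: "{g. g \<in> carrier G \<and> p \<in> A g} \<subseteq> {g \<in> carrier G. snd p \<in> tile g}" for p
    by (auto simp: A_def)
  have A_finite: "finite {g. g \<in> carrier G \<and> p \<in> A g}" for p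
    by (rule finite_subset[OF A_sub finite_tiles_at])
  obtain B where B: "B \<ge> 0" "\<And>g. g \<in> carrier G \<Longrightarrow> \<bar>b g\<bar> \<le> B"
    using defect(2) bounded_functionsE[of b G] by (metis bounded_functions_def mem_Collect_eq)
  have chain: "one_chain (controlled_sets G \<phi>) \<mu> c"
    unfolding one_chain_iff
  proof (intro conjI bexI)
    have "c \<in> borel_measurable (\<mu> \<Otimes>\<^sub>M \<mu>)"
      unfolding c_def by (intro borel_measurable_locally_finite_sum countable_carrier A_sets A_finite)
    moreover have "\<bar>c p\<bar> \<le> real (card (meeting_set G \<phi> S)) * B" for p
      unfolding c_def using B by (intro sum_tiles_at_bound[OF _ _ A_sub]) auto
    ultimately show "ess_bounded (\<mu> \<Otimes>\<^sub>M \<mu>) c" by (rule ess_boundedI)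
    have "c p = 0" if "p \<notin> (\<Union>g\<in>carrier G. A g)" for p
      unfolding c_def using that by (intro sum.neutral) auto
    then show "AE p in \<mu> \<Otimes>\<^sub>M \<mu>. p \<notin> (\<Union>g\<in>carrier G. A g) \<longrightarrow> c p = 0" by simp
    let ?C = "tile (inv h) \<union> S"
    have "(\<Union>g\<in>carrier G. A g) \<in> controlled_sets G \<phi>"
    proof (rule controlled_setsI)
      show "compact ?C" using h by (intro compact_Un compact_image_act compact_S) auto
      fix x y assume "(x, y) \<in> (\<Union>g\<in>carrier G. A g)"
      then obtain g where g: "g \<in> carrier G" "x \<in> tile (g \<otimes> inv h)" "y \<in> tile g"
        unfolding A_def by blast
      have "tile (g \<otimes> inv h) = \<phi> g ` tile (inv h)" using g(1) h by (intro image_act_mult) auto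
      then show "\<exists>g\<in>carrier G. x \<in> \<phi> g ` ?C \<and> y \<in> \<phi> g ` ?C"
        using g by (auto simp: image_Un)
    qed
    moreover have "(\<Union>g\<in>carrier G. A g) \<in> sets (\<mu> \<Otimes>\<^sub>M \<mu>)"
      by (intro sets.countable_UN'' countable_carrier A_sets)
    ultimately show "(\<Union>g\<in>carrier G. A g) \<in> controlled_sets G \<phi> \<inter> sets (\<mu> \<Otimes>\<^sub>M \<mu>)" by blast
  qed
  \<comment> \<open>\<open>D x\<close> indexes the terms that flow out of \<open>x\<close>, and \<open>T x\<close> those that flow into \<open>x\<close>\<close>
  define D where "D x = {g \<in> carrier G. x \<in> tile (g \<otimes> inv h)}" for x
  define T where "T x = {g \<in> carrier G. x \<in> tile g}" for x
  have D_bij: "bij_betw (\<lambda>k. k \<otimes> h) (T x) (D x)" for x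
    by (rule bij_betwI[where g="\<lambda>g. g \<otimes> inv h"]) (use h in \<open>auto simp: m_assoc D_def T_def\<close>)
  have T_finite: "finite (T x)" for x unfolding T_def by (rule finite_tiles_at)
  have D_finite: "finite (D x)" for x
    using bij_betw_finite[OF D_bij] T_finite by simp
  have out: "(\<lambda>y. c (x, y)) = (\<lambda>y. \<Sum>g\<in>D x. b (inv g) * indicator (tile g) y)" for x
    unfolding c_def
    by (intro ext sum.mono_neutral_cong_left D_finite) (auto simp: D_def A_def indicator_def)
  have inn: "(\<lambda>y. c (y, x)) = (\<lambda>y. \<Sum>g\<in>T x. b (inv g) * indicator (tile (g \<otimes> inv h)) y)" for x
    unfolding c_def
    by (intro ext sum.mono_neutral_cong_left T_finite) (auto simp: T_def A_def indicator_def)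
  have out_int: "integrable \<mu> (\<lambda>y. c (x, y))" for x
    unfolding out by (rule tile_combination[OF D_finite]) (simp add: D_def)
  have inn_int: "integrable \<mu> (\<lambda>y. c (y, x))" for x
    unfolding inn by (rule tile_combination[OF T_finite]) (use h in \<open>simp add: T_def\<close>)
  have "boundary \<mu> c x = measure \<mu> S * (\<Sum>g\<in>T x. b (inv g) - b (inv h \<otimes> inv g))" for x
  proof -
    have "(LINT y|\<mu>. c (x, y)) = measure \<mu> S * (\<Sum>g\<in>D x. b (inv g))"
      unfolding out by (rule tile_combination[OF D_finite]) (simp add: D_def)
    also have "(\<Sum>g\<in>D x. b (inv g)) = (\<Sum>g\<in>T x. b (inv (g \<otimes> h)))"
      by (rule sum.reindex_bij_betw[OF D_bij, symmetric])
    also have "\<dots> = (\<Sum>g\<in>T x. b (inv h \<otimes> inv g))"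
      using h by (intro sum.cong) (auto simp: T_def inv_mult_group)
    finally have "(LINT y|\<mu>. c (x, y)) = measure \<mu> S * (\<Sum>g\<in>T x. b (inv h \<otimes> inv g))" .
    moreover have "(LINT y|\<mu>. c (y, x)) = measure \<mu> S * (\<Sum>g\<in>T x. b (inv g))"
      unfolding inn by (rule tile_combination[OF T_finite]) (use h in \<open>simp add: T_def\<close>)
    ultimately show ?thesis by (simp add: boundary_def sum_subtractf algebra_simps)
  qed
  then show ?case using chain out_int inn_int unfolding T_def by blast
next
  case (add v w)
  then obtain c d where
    c: "one_chain (controlled_sets G \<phi>) \<mu> c" "\<And>x. integrable \<mu> (\<lambda>y. c (x, y))"
      "\<And>x. integrable \<mu> (\<lambda>y. c (y, x))"
      "\<And>x. boundary \<mu> c x = measure \<mu> S * (\<Sum>g | g \<in> carrier G \<and> x \<in> tile g. v (inv g))"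
    and d: "one_chain (controlled_sets G \<phi>) \<mu> d" "\<And>x. integrable \<mu> (\<lambda>y. d (x, y))"
      "\<And>x. integrable \<mu> (\<lambda>y. d (y, x))"
      "\<And>x. boundary \<mu> d x = measure \<mu> S * (\<Sum>g | g \<in> carrier G \<and> x \<in> tile g. w (inv g))"
    by blast
  have "boundary \<mu> (\<lambda>p. c p + d p) x = boundary \<mu> c x + boundary \<mu> d x" for x
    unfolding boundary_def using c(2,3) d(2,3) by simp
  then show ?case
    using one_chain_add[OF c(1) d(1)] c(2-4) d(2-4)
    by (intro exI[of _ "\<lambda>p. c p + d p"]) (simp add: sum.distrib distrib_left)
next
  case (cong v w)
  have "(\<Sum>g | g \<in> carrier G \<and> x \<in> tile g. v (inv g)) = (\<Sum>g | g \<in> carrier G \<and> x \<in> tile g. w (inv g))" for x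
    by (rule sum.cong) (simp_all add: cong.hyps)
  then show ?case using cong.IH by simp
qed

text \<open>
  The effectiveness witness is the union of the squares of all tiles: its section at \<open>x\<close> contains
  a whole tile through \<open>x\<close> and so has measure at least \<open>\<mu> S\<close>.
\<close>

lemma ponzi_scheme_if_not_amenable:
  assumes "\<not> amenable G"
  shows "\<exists>c. ponzi_scheme (controlled_sets G \<phi>) \<mu> c"
proof -
  define M where "M = measure \<mu> S"
  have M: "M > 0" using measure_S_pos by (simp add: M_def)
  obtain v0 where v0: "v0 \<in> translation_defects G" "\<And>x. x \<in> carrier G \<Longrightarrow> v0 x \<ge> 1"
    using positive_defect_if_not_amenable[OF assms] by blast
  \<comment> \<open>one factor \<open>M\<close> is gained in passing from the defect to the boundary, the other in integrating
    the boundary over a tile\<close>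
  define v where "v x = (1 / M\<^sup>2) * v0 x" for x
  have v: "v \<in> translation_defects G" unfolding v_def by (rule translation_defects_scale[OF v0(1)])
  have v_ge: "1 / M\<^sup>2 \<le> v x" if "x \<in> carrier G" for x
    using v0(2)[OF that] M by (simp add: v_def divide_simps)
  obtain B where B: "B \<ge> 0" "\<And>x. x \<in> carrier G \<Longrightarrow> \<bar>v x\<bar> \<le> B"
    using bounded_functionsE[OF translation_defects_bounded[OF v]] by blast
  define T where "T x = {g. g \<in> carrier G \<and> x \<in> tile g}" for x
  have T_finite: "finite (T x)" for x unfolding T_def by (rule finite_tiles_at)
  obtain c where c: "one_chain (controlled_sets G \<phi>) \<mu> c"
    and bd: "\<And>x. boundary \<mu> c x = M * (\<Sum>g\<in>T x. v (inv g))"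
    using defect_is_boundary[OF v] unfolding M_def T_def by blast
  have bd_ge: "1 / M \<le> boundary \<mu> c x" for x
  proof -
    obtain k where k: "k \<in> T x" unfolding T_def using tile_at[of x] by blast
    have nonneg: "0 \<le> v (inv g)" if "g \<in> T x" for g
      using that v_ge[of "inv g"] M by (simp add: T_def) (smt (verit) divide_nonneg_nonneg zero_le_power2)
    have "1 / M\<^sup>2 \<le> v (inv k)" using k v_ge by (simp add: T_def)
    also have "\<dots> \<le> (\<Sum>g\<in>T x. v (inv g))" by (rule member_le_sum) (use k nonneg T_finite in auto)
    finally have "M * (1 / M\<^sup>2) \<le> boundary \<mu> c x"
      unfolding bd using M by (intro mult_left_mono) auto
    then show ?thesis using M by (simp add: power2_eq_square)
  qed
  have bd_le: "\<bar>boundary \<mu> c x\<bar> \<le> M * (real (card (meeting_set G \<phi> S)) * B)" for x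
  proof -
    have "\<bar>\<Sum>g\<in>T x. v (inv g)\<bar> \<le> real (card (meeting_set G \<phi> S)) * B"
      by (rule sum_tiles_at_bound) (use B in \<open>auto simp: T_def\<close>)
    then show ?thesis unfolding bd using M by (simp add: abs_mult)
  qed
  have bd_meas: "boundary \<mu> c \<in> borel_measurable \<mu>"
  proof -
    have "(\<lambda>x. \<Sum>g\<in>T x. v (inv g)) \<in> borel_measurable \<mu>"
      unfolding T_def
      by (intro borel_measurable_locally_finite_sum countable_carrier tile_sets finite_tiles_at)
    then have "(\<lambda>x. M * (\<Sum>g\<in>T x. v (inv g))) \<in> borel_measurable \<mu>" by (intro borel_measurable_times borel_measurable_const)
    then show ?thesis by (simp add: bd[abs_def])
  qed
  define E where "E = (\<Union>g\<in>carrier G. tile g \<times> tile g)"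
  have E: "E \<in> controlled_sets G \<phi> \<inter> sets (\<mu> \<Otimes>\<^sub>M \<mu>)"
  proof
    show "E \<in> controlled_sets G \<phi>" by (rule controlled_setsI[OF compact_S]) (auto simp: E_def)
    show "E \<in> sets (\<mu> \<Otimes>\<^sub>M \<mu>)" unfolding E_def
      by (intro sets.countable_UN'' countable_carrier pair_measureI tile_sets)
  qed
  have "1 \<le> (LINT y:(E `` {x})|\<mu>. boundary \<mu> c y)" for x
  proof -
    have Ex: "E `` {x} = (\<Union>g\<in>T x. tile g)" by (auto simp: E_def T_def)
    have Ex_compact: "compact (E `` {x})"
      unfolding Ex by (intro compact_UN T_finite compact_image_act compact_S) (simp add: T_def)
    note Ex_fin = finite_compact[OF Ex_compact] and Ex_sets = compact_sets[OF Ex_compact]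
    obtain k where k: "k \<in> carrier G" "x \<in> tile k" by (rule tile_at)
    have "1 = M * (1 / M)" using M by simp
    also have "\<dots> \<le> measure \<mu> (E `` {x}) * (1 / M)"
    proof (rule mult_right_mono)
      have "measure \<mu> (tile k) \<le> measure \<mu> (E `` {x})"
        using k Ex_fin Ex_sets by (intro measure_mono_fmeasurable tile_sets fmeasurableI) (auto simp: Ex T_def)
      then show "M \<le> measure \<mu> (E `` {x})" using k by (simp add: M_def measure_tile)
    qed (use M in simp)
    also have "\<dots> = (LINT y:(E `` {x})|\<mu>. 1 / M)"
      using Ex_sets Ex_fin by (simp add: set_integral_const)
    also have "\<dots> \<le> (LINT y:(E `` {x})|\<mu>. boundary \<mu> c y)"
    proof (rule set_integral_mono)
      show "set_integrable \<mu> (E `` {x}) (\<lambda>y. 1 / M)"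
        using Ex_sets Ex_fin by (auto simp: set_integrable_def intro!: integrableI_bounded_set_indicator)
      show "set_integrable \<mu> (E `` {x}) (boundary \<mu> c)"
        unfolding set_integrable_def
        by (rule integrableI_bounded_set_indicator[OF Ex_sets bd_meas Ex_fin]) (use bd_le in auto)
    qed (rule bd_ge)
    finally show ?thesis .
  qed
  moreover have "zero_chain \<mu> (boundary \<mu> c)"
    unfolding zero_chain_def by (rule ess_boundedI[OF bd_meas bd_le])
  moreover have "0 \<le> boundary \<mu> c x" for x
    using bd_ge[of x] M by (smt (verit) divide_pos_pos)
  ultimately have "effective_chain (controlled_sets G \<phi>) \<mu> (boundary \<mu> c)"
    unfolding effective_chain_def using E by blast
  then show ?thesis using c by (auto simp: ponzi_scheme_def)
qed


section \<open>From a Ponzi scheme to a positive defect\<close>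

text \<open>
  Enumerate the group and remove from each tile all tiles that come earlier in the enumeration.
  The pieces need not be translates of each other; their measures are bounded by that of a tile.
\<close>

lemma borel_partition_into_tiles:
  obtains A where "\<And>g. g \<in> carrier G \<Longrightarrow> A g \<in> sets \<mu>" "\<And>g. A g \<subseteq> tile g"
    "\<And>x. \<exists>g\<in>carrier G. x \<in> A g" "disjoint_family_on A (carrier G)"
proof -
  define i where "i = to_nat_on (carrier G)"
  define A where "A g = tile g - (\<Union>h\<in>{h \<in> carrier G. i h < i g}. tile h)" for g
  have inj: "inj_on i (carrier G)" unfolding i_def by (rule inj_on_to_nat_on[OF countable_carrier])
  show thesis
  proof (rule that[of A])
    show "A g \<in> sets \<mu>" if "g \<in> carrier G" for g
    proof -
      have "countable {h \<in> carrier G. i h < i g}"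
        by (rule countable_subset[OF _ countable_carrier]) blast
      then have "(\<Union>h\<in>{h \<in> carrier G. i h < i g}. tile h) \<in> sets \<mu>"
        by (rule sets.countable_UN'') (simp only: mem_Collect_eq tile_sets)
      then show ?thesis unfolding A_def by (rule sets.Diff[OF tile_sets[OF that]])
    qed
    show "A g \<subseteq> tile g" for g unfolding A_def by blast
    show "\<exists>g\<in>carrier G. x \<in> A g" for x
    proof -
      obtain h where "h \<in> carrier G \<and> x \<in> tile h" using tile_at by blast
      then obtain g where g: "g \<in> carrier G \<and> x \<in> tile g"
        and least: "\<forall>h. h \<in> carrier G \<and> x \<in> tile h \<longrightarrow> i g \<le> i h"
        using ex_has_least_nat[of "\<lambda>g. g \<in> carrier G \<and> x \<in> tile g" h i] by blast
      have "x \<in> A g" unfolding A_def using g least by fastforce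
      then show ?thesis using g by blast
    qed
    show "disjoint_family_on A (carrier G)"
      unfolding disjoint_family_on_def
    proof (intro ballI impI)
      fix g h assume gh: "g \<in> carrier G" "h \<in> carrier G" "g \<noteq> h"
      then have "i g \<noteq> i h" using inj by (auto dest: inj_onD)
      then have "i g < i h \<or> i h < i g" by linarith
      then show "A g \<inter> A h = {}" unfolding A_def using gh by blast
    qed
  qed
qed

sublocale pair: pair_sigma_finite \<mu> \<mu> ..

text \<open>
  The integral of the boundary over \<open>A g\<close> is what the chain carries into \<open>A g\<close> minus what it carries
  out.  By Fubini these are its integrals over the strips \<open>UNIV \<times> A g\<close> and \<open>A g \<times> UNIV\<close>, and in each
  strip only the finitely many rectangles formed with the pieces \<open>A (g \<otimes> p)\<close> contribute.
\<close>

lemma flux_through_pieces: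
  assumes A: "\<And>g. g \<in> carrier G \<Longrightarrow> A g \<in> sets \<mu>" "\<And>g. A g \<subseteq> tile g"
      "\<And>x. \<exists>g\<in>carrier G. x \<in> A g" "disjoint_family_on A (carrier G)"
    and c: "one_chain (controlled_sets G \<phi>) \<mu> c"
  defines "T \<equiv> \<lambda>g h. LINT p|(\<mu> \<Otimes>\<^sub>M \<mu>). indicator (A g \<times> A h) p * c p"
  obtains P where "finite P" "P \<subseteq> carrier G" "\<And>p. p \<in> P \<Longrightarrow> inv p \<in> P"
    "\<And>g. g \<in> carrier G \<Longrightarrow> (LINT x|\<mu>. indicator (A g) x * boundary \<mu> c x)
      = (\<Sum>p\<in>P. T (g \<otimes> p) g - T g (g \<otimes> p))"
    "\<exists>B. \<forall>g\<in>carrier G. \<forall>h\<in>carrier G. \<bar>T g h\<bar> \<le> B"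
proof -
  let ?\<nu> = "\<mu> \<Otimes>\<^sub>M \<mu>"
  obtain B E where c_meas: "c \<in> borel_measurable ?\<nu>" and bound: "AE p in ?\<nu>. \<bar>c p\<bar> \<le> B"
    and E: "E \<in> controlled_sets G \<phi>" and supp: "AE p in ?\<nu>. p \<notin> E \<longrightarrow> c p = 0"
    using c unfolding one_chain_iff ess_bounded_def by blast
  obtain P where P: "finite P" "P \<subseteq> carrier G" "\<And>p. p \<in> P \<Longrightarrow> inv p \<in> P"
    and near: "\<And>g x y. g \<in> carrier G \<Longrightarrow> (x, y) \<in> E \<or> (y, x) \<in> E \<Longrightarrow> x \<in> tile g \<Longrightarrow>
      {h \<in> carrier G. y \<in> tile h} \<subseteq> (\<lambda>p. g \<otimes> p) ` P"
    by (rule controlled_sets_section[OF E]) (rule that)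
  have A_le: "emeasure \<mu> (A g) \<le> emeasure \<mu> S" if "g \<in> carrier G" for g
    using emeasure_mono[OF A(2) tile_sets[OF that]] emeasure_tile[OF that] by simp
  have rect: "A g \<times> A h \<in> sets ?\<nu>" if "g \<in> carrier G" "h \<in> carrier G" for g h
    using that by (intro pair_measureI A)
  have rect_le: "emeasure ?\<nu> (A g \<times> A h) \<le> emeasure \<mu> S * emeasure \<mu> S"
    if "g \<in> carrier G" "h \<in> carrier G" for g h
    unfolding emeasure_pair_measure_Times[OF A(1)[OF that(1)] A(1)[OF that(2)]]
    by (intro mult_mono A_le that) simp_all
  have S_fin: "emeasure \<mu> S * emeasure \<mu> S < \<infinity>"
    using finite_compact[OF compact_S] by (simp add: ennreal_mult_less_top)
  have rect_fin: "emeasure ?\<nu> (A g \<times> A h) < \<infinity>" if "g \<in> carrier G" "h \<in> carrier G" for g h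
    using rect_le[OF that] S_fin by (rule le_less_trans)
  have disjoint: "disjoint_family_on (\<lambda>p. A (g \<otimes> p)) P" if g: "g \<in> carrier G" for g
    unfolding disjoint_family_on_def
  proof (intro ballI impI)
    fix p q assume pq: "p \<in> P" "q \<in> P" "p \<noteq> q"
    then have "p \<in> carrier G" "q \<in> carrier G" using P(2) by blast+
    then have "g \<otimes> p \<in> carrier G" "g \<otimes> q \<in> carrier G" "g \<otimes> p \<noteq> g \<otimes> q"
      using g pq(3) by simp_all
    then show "A (g \<otimes> p) \<inter> A (g \<otimes> q) = {}" by (rule disjoint_family_onD[OF A(4)])
  qed
  have near_A: "\<exists>p\<in>P. y \<in> A (g \<otimes> p)"
    if g: "g \<in> carrier G" and xy: "(x, y) \<in> E \<or> (y, x) \<in> E" and x: "x \<in> A g" for g x y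
  proof -
    obtain h where h: "h \<in> carrier G" "y \<in> A h" using A(3) by blast
    then have "h \<in> (\<lambda>p. g \<otimes> p) ` P" using near[OF g xy] x A(2) by blast
    then show ?thesis using h by blast
  qed
  have flux: "(LINT x|\<mu>. indicator (A g) x * boundary \<mu> c x)
      = (\<Sum>p\<in>P. T (g \<otimes> p) g - T g (g \<otimes> p))" if g: "g \<in> carrier G" for g
  proof -
    have gp: "g \<otimes> p \<in> carrier G" if "p \<in> P" for p using g that P(2) by blast
    have col_sets: "UNIV \<times> A g \<in> sets ?\<nu>" and row_sets: "A g \<times> UNIV \<in> sets ?\<nu>"
      using sets.top[of \<mu>] by (intro pair_measureI A(1) g; simp)+
    have col_R: "A (g \<otimes> p) \<times> A g \<in> sets ?\<nu>" "emeasure ?\<nu> (A (g \<otimes> p) \<times> A g) < \<infinity>"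
        "A (g \<otimes> p) \<times> A g \<subseteq> UNIV \<times> A g" if "p \<in> P" for p
      using rect[OF gp[OF that] g] rect_fin[OF gp[OF that] g] by blast+
    have row_R: "A g \<times> A (g \<otimes> p) \<in> sets ?\<nu>" "emeasure ?\<nu> (A g \<times> A (g \<otimes> p)) < \<infinity>"
        "A g \<times> A (g \<otimes> p) \<subseteq> A g \<times> UNIV" if "p \<in> P" for p
      using rect[OF g gp[OF that]] rect_fin[OF g gp[OF that]] by blast+
    have col_disjoint: "disjoint_family_on (\<lambda>p. A (g \<otimes> p) \<times> A g) P"
      and row_disjoint: "disjoint_family_on (\<lambda>p. A g \<times> A (g \<otimes> p)) P"
      using disjoint[OF g] unfolding disjoint_family_on_def by blast+
    have col_supp: "AE p in ?\<nu>. p \<in> UNIV \<times> A g \<longrightarrow> c p \<noteq> 0 \<longrightarrow> p \<in> (\<Union>i\<in>P. A (g \<otimes> i) \<times> A g)"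
      using supp by eventually_elim (use near_A[OF g] in fastforce)
    have row_supp: "AE p in ?\<nu>. p \<in> A g \<times> UNIV \<longrightarrow> c p \<noteq> 0 \<longrightarrow> p \<in> (\<Union>i\<in>P. A g \<times> A (g \<otimes> i))"
      using supp by eventually_elim (use near_A[OF g] in fastforce)
    note col = integral_finite_partition[OF c_meas bound col_sets P(1) col_R col_disjoint col_supp]
    note row = integral_finite_partition[OF c_meas bound row_sets P(1) row_R row_disjoint row_supp]
    have col_form: "(\<lambda>p. indicator (UNIV \<times> A g) p * c p) = (\<lambda>(y, x). indicator (A g) x * c (y, x))"
      and row_form: "(\<lambda>p. indicator (A g \<times> UNIV) p * c p) = (\<lambda>(x, y). indicator (A g) x * c (x, y))"
      by (auto simp: indicator_def fun_eq_iff)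
    note colF = pair.integrable_snd[OF col(1)[unfolded col_form]]
      pair.integral_snd[OF col(1)[unfolded col_form]]
    note rowF = pair.integrable_fst[OF row(1)[unfolded row_form]]
      pair.integral_fst[OF row(1)[unfolded row_form]]
    have "(LINT x|\<mu>. indicator (A g) x * boundary \<mu> c x) =
        (LINT x|\<mu>. (LINT y|\<mu>. indicator (A g) x * c (y, x)) - (LINT y|\<mu>. indicator (A g) x * c (x, y)))"
      by (simp add: boundary_def right_diff_distrib)
    also have "\<dots> = (\<Sum>p\<in>P. T (g \<otimes> p) g) - (\<Sum>p\<in>P. T g (g \<otimes> p))"
      using Bochner_Integration.integral_diff[OF colF(1) rowF(1)] colF(2) rowF(2) col(2) row(2)
      by (simp only: col_form row_form T_def)
    finally show ?thesis by (simp only: sum_subtractf)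
  qed
  have T_le: "\<bar>T g h\<bar> \<le> \<bar>B\<bar> * (measure \<mu> S * measure \<mu> S)"
    if gh: "g \<in> carrier G" "h \<in> carrier G" for g h
  proof -
    have int: "integrable ?\<nu> (\<lambda>p. indicator (A g \<times> A h) p * c p)"
      by (rule integrable_indicator_times_ess_bounded[OF rect[OF gh] rect_fin[OF gh] c_meas bound])
    have int1: "integrable ?\<nu> (indicator (A g \<times> A h) :: _ \<Rightarrow> real)"
      using rect[OF gh] rect_fin[OF gh] by (rule integrable_real_indicator)
    have "\<bar>T g h\<bar> \<le> (LINT p|?\<nu>. \<bar>indicator (A g \<times> A h) p * c p\<bar>)"
      unfolding T_def by (rule integral_abs_bound)
    also have "\<dots> \<le> (LINT p|?\<nu>. \<bar>B\<bar> * indicator (A g \<times> A h) p)"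
    proof (rule integral_mono_AE[OF integrable_abs[OF int] integrable_mult_right[OF int1]])
      show "AE p in ?\<nu>. \<bar>indicator (A g \<times> A h) p * c p\<bar> \<le> \<bar>B\<bar> * indicator (A g \<times> A h) p"
        using bound by eventually_elim (auto simp: indicator_def)
    qed
    also have "\<dots> = \<bar>B\<bar> * measure ?\<nu> (A g \<times> A h)"
      using rect[OF gh] by simp
    also have "measure ?\<nu> (A g \<times> A h) \<le> measure \<mu> S * measure \<mu> S"
      using enn2real_mono[OF rect_le[OF gh]] S_fin by (simp add: measure_def enn2real_mult)
    finally show ?thesis by (simp add: mult_left_mono)
  qed
  have bounded: "\<exists>B. \<forall>g\<in>carrier G. \<forall>h\<in>carrier G. \<bar>T g h\<bar> \<le> B"
    by (intro exI ballI) (rule T_le)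
  show thesis by (rule that[OF P flux bounded])
qed

text \<open>
  The sections of the witness of effectiveness at the points \<open>g x\<^sub>0\<close> of one orbit are each covered by
  pieces \<open>A (g \<otimes> r)\<close>, with \<open>r\<close> in a finite set that does not depend on \<open>g\<close>.
\<close>

lemma effective_chain_mass:
  assumes A: "\<And>g. g \<in> carrier G \<Longrightarrow> A g \<in> sets \<mu>" "\<And>g. A g \<subseteq> tile g"
      "\<And>x. \<exists>g\<in>carrier G. x \<in> A g"
    and f: "effective_chain (controlled_sets G \<phi>) \<mu> f"
  obtains R where "finite R" "R \<subseteq> carrier G"
    "\<And>g. g \<in> carrier G \<Longrightarrow> 1 \<le> (\<Sum>r\<in>R. LINT x|\<mu>. indicator (A (g \<otimes> r)) x * f x)"
proof -
  obtain B E where f_meas: "f \<in> borel_measurable \<mu>" and bound: "AE x in \<mu>. \<bar>f x\<bar> \<le> B"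
    and nonneg: "AE x in \<mu>. f x \<ge> 0" and E: "E \<in> controlled_sets G \<phi>" "E \<in> sets (\<mu> \<Otimes>\<^sub>M \<mu>)"
    and ge: "\<And>x. (LINT y:(E `` {x})|\<mu>. f y) \<ge> 1"
    using f unfolding effective_chain_def zero_chain_def ess_bounded_def by blast
  obtain P where P: "finite P" "P \<subseteq> carrier G" "\<And>p. p \<in> P \<Longrightarrow> inv p \<in> P"
    and near: "\<And>g x y. g \<in> carrier G \<Longrightarrow> (x, y) \<in> E \<or> (y, x) \<in> E \<Longrightarrow> x \<in> tile g \<Longrightarrow>
      {h \<in> carrier G. y \<in> tile h} \<subseteq> (\<lambda>p. g \<otimes> p) ` P"
    by (rule controlled_sets_section[OF E(1)]) (rule that)
  obtain k and x0 :: 'x where k: "k \<in> carrier G" "x0 \<in> tile k" by (rule tile_at)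
  show thesis
  proof (rule that[of "(\<lambda>p. k \<otimes> p) ` P"])
    show "finite ((\<lambda>p. k \<otimes> p) ` P)" using P(1) by simp
    show R: "(\<lambda>p. k \<otimes> p) ` P \<subseteq> carrier G" using P(2) k(1) by blast
    fix g assume g: "g \<in> carrier G"
    let ?R = "(\<lambda>p. k \<otimes> p) ` P" and ?x = "\<phi> g x0"
    have gr: "g \<otimes> r \<in> carrier G" if "r \<in> ?R" for r using that R g by blast
    have cover_section: "\<exists>r\<in>?R. y \<in> A (g \<otimes> r)" if y: "y \<in> E `` {?x}" for y
    proof -
      obtain h where h: "h \<in> carrier G" "y \<in> A h" using A(3) by blast
      have "?x \<in> tile (g \<otimes> k)" using k g by (simp add: image_act_mult)
      then have "h \<in> (\<lambda>p. g \<otimes> k \<otimes> p) ` P"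
        using near[of "g \<otimes> k" ?x y] y h A(2) g k(1) by blast
      then obtain p where p: "p \<in> P" "h = g \<otimes> k \<otimes> p" by blast
      then have "h = g \<otimes> (k \<otimes> p)" using g k(1) P(2) by (auto simp: m_assoc)
      then show ?thesis using p(1) h(2) by blast
    qed
    have int: "integrable \<mu> (\<lambda>y. indicator (A (g \<otimes> r)) y * f y)" if r: "r \<in> ?R" for r
    proof -
      have "emeasure \<mu> (A (g \<otimes> r)) < \<infinity>"
        using emeasure_mono[OF A(2) tile_sets[OF gr[OF r]]] emeasure_tile_finite[OF gr[OF r]]
        by (rule le_less_trans)
      then show ?thesis
        by (rule integrable_indicator_times_ess_bounded[OF A(1)[OF gr[OF r]] _ f_meas bound])
    qed
    have sum_int: "integrable \<mu> (\<lambda>y. \<Sum>r\<in>?R. indicator (A (g \<otimes> r)) y * f y)"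
      by (intro Bochner_Integration.integrable_sum int)
    have le: "AE y in \<mu>. 0 \<le> indicator (E `` {?x}) y * f y \<and>
        indicator (E `` {?x}) y * f y \<le> (\<Sum>r\<in>?R. indicator (A (g \<otimes> r)) y * f y)"
      using nonneg
    proof eventually_elim
      case (elim y)
      have terms: "0 \<le> indicator (A (g \<otimes> r)) y * f y" for r using elim by simp
      show ?case
      proof (cases "y \<in> E `` {?x}")
        case True
        then obtain r where r: "r \<in> ?R" "y \<in> A (g \<otimes> r)" using cover_section by blast
        have "f y = indicator (A (g \<otimes> r)) y * f y" using r(2) by simp
        also have "\<dots> \<le> (\<Sum>r\<in>?R. indicator (A (g \<otimes> r)) y * f y)"
          by (rule member_le_sum) (use r(1) P(1) terms in auto)
        finally show ?thesis using True elim by simp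
      qed (use sum_nonneg[OF terms] in simp)
    qed
    have section_sets: "E `` {?x} \<in> sets \<mu>"
      using sets_Pair1[OF E(2), of ?x] by (simp only: Image_singleton vimage_def)
    have meas: "(\<lambda>y. indicator (E `` {?x}) y * f y) \<in> borel_measurable \<mu>"
      by (intro borel_measurable_times borel_measurable_indicator section_sets f_meas)
    have "integrable \<mu> (\<lambda>y. indicator (E `` {?x}) y * f y)"
      by (rule Bochner_Integration.integrable_bound[OF sum_int meas]) (use le in eventually_elim, simp)
    moreover have "AE y in \<mu>. indicator (E `` {?x}) y * f y \<le> (\<Sum>r\<in>?R. indicator (A (g \<otimes> r)) y * f y)"
      using le by eventually_elim simp
    ultimately have "(LINT y|\<mu>. indicator (E `` {?x}) y * f y) \<le>
        (LINT y|\<mu>. (\<Sum>r\<in>?R. indicator (A (g \<otimes> r)) y * f y))"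
      using sum_int by (intro integral_mono_AE)
    also have "\<dots> = (\<Sum>r\<in>?R. LINT y|\<mu>. indicator (A (g \<otimes> r)) y * f y)"
      by (intro Bochner_Integration.integral_sum int)
    finally show "1 \<le> (\<Sum>r\<in>?R. LINT y|\<mu>. indicator (A (g \<otimes> r)) y * f y)"
      using ge[of ?x] by (simp add: set_lebesgue_integral_def)
  qed
qed

text \<open>
  With \<open>u p g = T (g\<inverse>) (g\<inverse> p)\<close>, the flux formula at \<open>g\<inverse>\<close> expresses \<open>F (g\<inverse>)\<close> as the sum over \<open>P\<close> of
  \<open>u p (p g) - u p g\<close>: the symmetry of \<open>P\<close> allows \<open>p\<close> to be replaced by its inverse in the incoming
  terms.  This exhibits a defect, and the lower bound comes from a sum of its translates.
\<close>

lemma not_amenable_if_ponzi_scheme: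
  assumes "ponzi_scheme (controlled_sets G \<phi>) \<mu> c"
  shows "\<not> amenable G"
proof -
  have c: "one_chain (controlled_sets G \<phi>) \<mu> c"
    and eff: "effective_chain (controlled_sets G \<phi>) \<mu> (boundary \<mu> c)"
    using assms by (simp_all add: ponzi_scheme_def)
  obtain A where A: "\<And>g. g \<in> carrier G \<Longrightarrow> A g \<in> sets \<mu>" "\<And>g. A g \<subseteq> tile g"
      "\<And>x. \<exists>g\<in>carrier G. x \<in> A g" "disjoint_family_on A (carrier G)"
    by (rule borel_partition_into_tiles) (rule that)
  define T where "T g h = (LINT p|(\<mu> \<Otimes>\<^sub>M \<mu>). indicator (A g \<times> A h) p * c p)" for g h
  define F where "F g = (LINT x|\<mu>. indicator (A g) x * boundary \<mu> c x)" for g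
  obtain P where P: "finite P" "P \<subseteq> carrier G" "\<And>p. p \<in> P \<Longrightarrow> inv p \<in> P"
    and flux: "\<And>g. g \<in> carrier G \<Longrightarrow> F g = (\<Sum>p\<in>P. T (g \<otimes> p) g - T g (g \<otimes> p))"
    and T_bounded: "\<exists>B. \<forall>g\<in>carrier G. \<forall>h\<in>carrier G. \<bar>T g h\<bar> \<le> B"
    by (rule flux_through_pieces[OF A c, folded T_def F_def]) (assumption, rule that)
  obtain R where R: "finite R" "R \<subseteq> carrier G"
    and mass: "\<And>g. g \<in> carrier G \<Longrightarrow> 1 \<le> (\<Sum>r\<in>R. F (g \<otimes> r))"
    by (rule effective_chain_mass[OF A(1-3) eff, folded F_def]) (assumption, rule that)
  define u where "u p g = T (inv g) (inv g \<otimes> p)" for p g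
  have u_bounded: "u p \<in> bounded_functions G" if "p \<in> P" for p
  proof -
    obtain B where B: "\<forall>g\<in>carrier G. \<forall>h\<in>carrier G. \<bar>T g h\<bar> \<le> B" using T_bounded by blast
    have "p \<in> carrier G" using that P(2) by blast
    then show ?thesis using B by (intro bounded_functionsI[of _ _ B]) (simp add: u_def)
  qed
  have defect: "(\<lambda>g. F (inv g)) \<in> translation_defects G"
  proof (rule translation_defects.cong)
    show "(\<lambda>g. \<Sum>p\<in>P. (-1) * (u p g - u p (inv (inv p) \<otimes> g))) \<in> translation_defects G"
      using P u_bounded
      by (intro translation_defects_sum translation_defects_scale defectI) auto
    fix g assume g: "g \<in> carrier G"
    have "bij_betw (\<lambda>p. inv p) P P"
      by (rule bij_betwI[where g="\<lambda>p. inv p"]) (use P in auto)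
    then have "(\<Sum>p\<in>P. T (inv g \<otimes> p) (inv g)) = (\<Sum>p\<in>P. T (inv g \<otimes> inv p) (inv g))"
      by (rule sum.reindex_bij_betw[symmetric])
    also have "\<dots> = (\<Sum>p\<in>P. u p (p \<otimes> g))"
    proof (rule sum.cong[OF refl])
      fix p assume "p \<in> P"
      then have p: "p \<in> carrier G" using P(2) by blast
      then have "inv (p \<otimes> g) = inv g \<otimes> inv p" "inv g \<otimes> inv p \<otimes> p = inv g"
        using g by (simp_all add: inv_mult_group m_assoc)
      then show "T (inv g \<otimes> inv p) (inv g) = u p (p \<otimes> g)" by (simp add: u_def)
    qed
    finally have "F (inv g) = (\<Sum>p\<in>P. u p (p \<otimes> g)) - (\<Sum>p\<in>P. u p g)"
      using flux[of "inv g"] g by (simp add: u_def sum_subtractf)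
    also have "\<dots> = (\<Sum>p\<in>P. (-1) * (u p g - u p (inv (inv p) \<otimes> g)))"
      unfolding sum_subtractf[symmetric] using P(2) by (intro sum.cong) auto
    finally show "(\<Sum>p\<in>P. (-1) * (u p g - u p (inv (inv p) \<otimes> g))) = F (inv g)" by simp
  qed
  show ?thesis
  proof (rule not_amenable_if_positive_defect)
    show "(\<lambda>x. \<Sum>r\<in>R. F (inv (inv r \<otimes> x))) \<in> translation_defects G"
      using R(2) by (intro translation_defects_sum translation_defects_translate[OF defect]) auto
    fix x assume x: "x \<in> carrier G"
    have "(\<Sum>r\<in>R. F (inv (inv r \<otimes> x))) = (\<Sum>r\<in>R. F (inv x \<otimes> r))"
      using x R(2) by (intro sum.cong) (auto simp: inv_mult_group)
    then show "1 \<le> (\<Sum>r\<in>R. F (inv (inv r \<otimes> x)))" using mass[of "inv x"] x by simp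
  qed
qed

end


theorem corollary1:
  fixes G :: "('g, 'b) monoid_scheme"
    and \<phi> :: "'g \<Rightarrow> 'x::{second_countable_topology, t2_space} \<Rightarrow> 'x"
    and \<mu> :: "'x measure"
  assumes "locally_compact_space (euclidean :: 'x topology)"
    and "group G"
    and "continuous_action G \<phi>"
    and "proper_action G \<phi>"
    and "cocompact_action G \<phi>"
    and "regular_measure \<mu>"
    and "invariant_measure G \<phi> \<mu>"
    and "emeasure \<mu> UNIV \<noteq> 0"
  shows "\<not> amenable G \<longleftrightarrow> (\<exists>c. ponzi_scheme (controlled_sets G \<phi>) \<mu> c)"
proof -
  obtain S where S: "compact S" "(\<Union>g\<in>carrier G. \<phi> g ` S) = UNIV"
    using \<open>cocompact_action G \<phi>\<close> unfolding cocompact_action_def by (elim exE conjE) (rule that)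
  interpret measured_cocompact_action G \<phi> \<mu> S
    by (intro measured_cocompact_action.intro measured_cocompact_action_axioms.intro assms S)
  show ?thesis
    using ponzi_scheme_if_not_amenable not_amenable_if_ponzi_scheme by blast
qed

end
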